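(* For the relative $\mathrm{SL}(3,\mathbb{C})$-character variety $\mathfrak{X}$ of the three-holed sphere $\Sigma_{3,0}$, with $\mathfrak{a}_{\pm4,5}=\{t_{(\pm4)},t_{(5)}\}$, one has $\mathfrak{a}_{-4,5}=-\mathfrak{i}(\mathfrak{a}_{4,5})$, where $\mathfrak{i}=\mathfrak{i}_1\mathfrak{t}\mathfrak{i}_1\mathfrak{t}$ is the outer automorphism $x_i\mapsto x_i^{-1}$, and the Poisson bi-vector field of $\mathfrak{X}$ is $$(P-2t_{(5)})\frac{\partial}{\partial t_{(4)}}\wedge\frac{\partial}{\partial t_{(-4)}}+(1-\mathfrak{i})\left(\frac{\partial(Q-t_{(5)}P)}{\partial t_{(-4)}}\frac{\partial}{\partial t_{(4)}}\wedge\frac{\partial}{\partial t_{(5)}}\right).$$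
   Context: Write $\pi_1(\Sigma_{3,0})=\langle x_1,x_2,x_3\mid x_3x_2x_1=1\rangle$ with $x_1,x_2,x_3$ the boundary curves; it is free on $x_1,x_2$. Let $\mathfrak{G}=\mathrm{SL}(3,\mathbb{C})$; then $\mathfrak{X}=\mathfrak{G}^{\times2}/\!\!/\mathfrak{G}$ (quotient by simultaneous conjugation), together with its boundary map. With generic matrices $X_1,X_2\in\mathfrak G$ (images of $x_1,x_2$), put $t_{(1)}=\mathrm{tr}(X_1)$, $t_{(-1)}=\mathrm{tr}(X_1^{-1})$, $t_{(2)}=\mathrm{tr}(X_2)$, $t_{(-2)}=\mathrm{tr}(X_2^{-1})$, $t_{(3)}=\mathrm{tr}(X_1X_2)$, $t_{(-3)}=\mathrm{tr}(X_1^{-1}X_2^{-1})$, $t_{(4)}=\mathrm{tr}(X_1X_2^{-1})$, $t_{(-4)}=\mathrm{tr}(X_1^{-1}X_2)$, $t_{(5)}=\mathrm{tr}(X_1X_2X_1^{-1}X_2^{-1})$, $t_{(-5)}=\mathrm{tr}(X_2X_1X_2^{-1}X_1^{-1})$. It is known that $\mathbb{C}[\mathfrak{X}]$ is generated by $t_{(\pm i)}$, $1\le i\le4$, and $t_{(5)}$, with the single relation $t_{(5)}^2-Pt_{(5)}+Q=0$ (where $P=t_{(5)}+t_{(-5)}$ and $Q=t_{(5)}t_{(-5)}$ in $\mathbb{C}[\mathfrak{X}]$), where $P,Q$ are the polynomials in $t_{(\pm i)}$, $1\le i\le4$, given by $$P=t_{(1)}t_{(-1)}t_{(2)}t_{(-2)}-t_{(1)}t_{(2)}t_{(-3)}-t_{(-1)}t_{(-2)}t_{(3)}-t_{(1)}t_{(-2)}t_{(-4)}-t_{(-1)}t_{(2)}t_{(4)}+t_{(1)}t_{(-1)}+t_{(2)}t_{(-2)}+t_{(3)}t_{(-3)}+t_{(4)}t_{(-4)}-3,$$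 \begin{align*} Q=&\,9-6t_{(1)}t_{(-1)}-6t_{(2)}t_{(-2)}-6t_{(3)}t_{(-3)}-6t_{(4)}t_{(-4)}+t_{(1)}^3+t_{(2)}^3+t_{(3)}^3+t_{(4)}^3\\ &+t_{(-1)}^3+t_{(-2)}^3+t_{(-3)}^3+t_{(-4)}^3-3t_{(-4)}t_{(-3)}t_{(-1)}-3t_{(4)}t_{(3)}t_{(1)}\\ &-3t_{(-4)}t_{(2)}t_{(3)}-3t_{(4)}t_{(-2)}t_{(-3)}+3t_{(-4)}t_{(-2)}t_{(1)}+3t_{(4)}t_{(2)}t_{(-1)}\\ &+3t_{(1)}t_{(2)}t_{(-3)}+3t_{(-1)}t_{(-2)}t_{(3)}+t_{(-2)}t_{(-1)}t_{(2)}t_{(1)}+t_{(-3)}t_{(-2)}t_{(3)}t_{(2)}\\ &+t_{(-4)}t_{(-1)}t_{(4)}t_{(1)}+t_{(-4)}t_{(-2)}t_{(4)}t_{(2)}+t_{(-3)}t_{(-1)}t_{(3)}t_{(1)}\\ &+t_{(-3)}t_{(-4)}t_{(3)}t_{(4)}+t_{(-4)}^2t_{(-3)}t_{(-2)}+t_{(4)}^2t_{(3)}t_{(2)}+t_{(-1)}^2t_{(-2)}t_{(-4)}+t_{(1)}^2t_{(2)}t_{(4)}\\ &+t_{(1)}t_{(-2)}^2t_{(-3)}+t_{(-1)}t_{(2)}^2t_{(3)}+t_{(-4)}t_{(-3)}t_{(1)}^2+t_{(4)}t_{(3)}t_{(-1)}^2\\ &+t_{(-4)}t_{(2)}t_{(-3)}^2+t_{(4)}t_{(-2)}t_{(3)}^2+t_{(-1)}^2t_{(-3)}t_{(2)}+t_{(1)}^2t_{(3)}t_{(-2)}\\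 &+t_{(-4)}t_{(1)}t_{(2)}^2+t_{(4)}t_{(-1)}t_{(-2)}^2+t_{(-4)}t_{(3)}t_{(-2)}^2+t_{(4)}t_{(-3)}t_{(2)}^2\\ &+t_{(1)}t_{(3)}t_{(-4)}^2+t_{(-1)}t_{(-3)}t_{(4)}^2+t_{(-1)}t_{(-4)}t_{(3)}^2+t_{(1)}t_{(4)}t_{(-3)}^2-2t_{(-3)}^2t_{(-2)}t_{(-1)}\\ &-2t_{(3)}^2t_{(2)}t_{(1)}-2t_{(-4)}^2t_{(-1)}t_{(2)}-2t_{(4)}^2t_{(1)}t_{(-2)}+t_{(-1)}^2t_{(-2)}^2t_{(-3)}+t_{(1)}^2t_{(2)}^2t_{(3)}\\ &+t_{(-4)}t_{(-1)}^2t_{(2)}^2+t_{(4)}t_{(1)}^2t_{(-2)}^2-t_{(-4)}t_{(-2)}^2t_{(2)}t_{(1)}-t_{(4)}t_{(2)}^2t_{(-2)}t_{(-1)}\\ &-t_{(-3)}t_{(1)}^2t_{(-1)}t_{(2)}-t_{(3)}t_{(-1)}^2t_{(1)}t_{(-2)}-t_{(-3)}t_{(2)}^2t_{(-2)}t_{(1)}-t_{(3)}t_{(-2)}^2t_{(2)}t_{(-1)}\\ &-t_{(-4)}t_{(-2)}t_{(-1)}t_{(1)}^2-t_{(4)}t_{(2)}t_{(1)}t_{(-1)}^2-t_{(-1)}t_{(-2)}^3t_{(1)}-t_{(-1)}t_{(2)}^3t_{(1)}\\ &-t_{(-1)}^3t_{(-2)}t_{(2)}-t_{(1)}^3t_{(-2)}t_{(2)}-t_{(-4)}t_{(-3)}t_{(-2)}t_{(-1)}t_{(2)}-t_{(4)}t_{(3)}t_{(2)}t_{(1)}t_{(-2)}\\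 &-t_{(-1)}t_{(1)}t_{(2)}t_{(-4)}t_{(3)}-t_{(-1)}t_{(1)}t_{(-2)}t_{(4)}t_{(-3)}+t_{(-2)}t_{(-1)}^2t_{(1)}^2t_{(2)}+t_{(-1)}t_{(-2)}^2t_{(2)}^2t_{(1)}. \end{align*} The partial derivatives of $Q-t_{(5)}P$ are taken in the polynomial ring in $t_{(\pm1)},\dots,t_{(\pm4)},t_{(5)}$. The Poisson bracket is the bilinear, anti-commutative derivation given on trace functions by $\{\mathrm{tr}(\rho(\alpha)),\mathrm{tr}(\rho(\beta))\}=\sum_{p\in\alpha\cap\beta}\epsilon(p,\alpha,\beta)\big(\mathrm{tr}(\rho(\alpha_p\beta_p))-\tfrac13\mathrm{tr}(\rho(\alpha))\mathrm{tr}(\rho(\beta))\big)$, where $\alpha,\beta$ are represented by immersed closed curves in generic position, $\alpha\cap\beta$ is the set of transverse double point intersections, $\epsilon(p,\alpha,\beta)=\pm1$ is the oriented intersection number at $p$, and $\alpha_p,\beta_p\in\pi_1(\Sigma_{3,0},p)$ are the curves based at $p$. The orientation of $\Sigma_{3,0}$ (reversing it multiplies the bracket by $-1$) is the one for which curves $\alpha,\beta$ freely homotopic to $x_1x_2^{-1}$ and $x_2x_1^{-1}$ meeting in two points $p,q$ with $\alpha_p\beta_p=x_2^{-1}x_1x_2x_1^{-1}$ and $\alpha_q\beta_q=x_1x_2^{-1}x_1^{-1}x_2$ (up to free homotopy) satisfy $\epsilon(p,\alpha,\beta)=-1$ and $\epsilon(q,\alpha,\beta)=1$. Bi-vector convention: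 a bi-vector field $\sum\mathfrak{a}_{i,j}\frac{\partial}{\partial z_i}\wedge\frac{\partial}{\partial z_j}$ corresponds to the bracket $\{f,g\}=\sum\mathfrak{a}_{i,j}\big(\frac{\partial f}{\partial z_i}\frac{\partial g}{\partial z_j}-\frac{\partial f}{\partial z_j}\frac{\partial g}{\partial z_i}\big)$, with each pair appearing in the displayed sum counted once; here the $z_i$ are the generators $t_{(\pm1)},\dots,t_{(\pm4)},t_{(5)}$. An outer automorphism $\sigma$ of the free group on $x_1,x_2$ acts on $\mathbb{C}[\mathfrak{X}]$ by $\mathrm{tr}(W)\mapsto\mathrm{tr}(\sigma(W))$; $\mathfrak{t}$ exchanges $x_1,x_2$, and $\mathfrak{i}_1$ sends $x_1\mapsto x_1^{-1}$, $x_2\mapsto x_2$. Thus $\mathfrak{i}$ exchanges $t_{(j)}$ and $t_{(-j)}$ for $1\le j\le4$ and fixes $t_{(5)}$. On bi-vector terms, $\mathfrak{i}\big(a\,\frac{\partial}{\partial u}\wedge\frac{\partial}{\partial v}\big)=\mathfrak{i}(a)\frac{\partial}{\partial\mathfrak{i}(u)}\wedge\frac{\partial}{\partial\mathfrak{i}(v)}$ for generators $u,v$. *)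

theory Defs
  imports
    "HOL-Complex_Analysis.Contour_Integration"
    "HOL-Library.Function_Algebras"
    "HOL-Library.Poly_Mapping"
begin

lemma matrix_inv_SL:
  fixes A :: "complex^3^3"
  assumes "det A = 1"
  shows "A ** matrix_inv A = mat 1" and "matrix_inv A ** A = mat 1"
proof -
  have "invertible A"
    using assms by (simp add: invertible_det_nz)
  then have "A ** matrix_inv A = mat 1 \<and> matrix_inv A ** A = mat 1"
    unfolding invertible_def matrix_inv_def by (rule someI_ex)
  then show "A ** matrix_inv A = mat 1" and "matrix_inv A ** A = mat 1"
    by auto
qed

typedef sl3 = "{A :: complex^3^3. det A = 1}"
  by (rule exI[of _ "mat 1"]) simp

setup_lifting type_definition_sl3

instantiation sl3 :: "{monoid_mult, inverse}"
begin

lift_definition one_sl3 :: sl3 is "mat 1"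
  by simp

lift_definition times_sl3 :: "sl3 \<Rightarrow> sl3 \<Rightarrow> sl3" is "(**)"
  by (simp add: det_mul)

lift_definition inverse_sl3 :: "sl3 \<Rightarrow> sl3" is matrix_inv
proof -
  fix A :: "complex^3^3"
  assume A: "det A = 1"
  from matrix_inv_SL(1)[OF A] have "det A * det (matrix_inv A) = 1"
    by (metis det_mul det_I)
  with A show "det (matrix_inv A) = 1"
    by simp
qed

definition divide_sl3 :: "sl3 \<Rightarrow> sl3 \<Rightarrow> sl3"
  where "divide_sl3 A B = A * inverse B"

instance
  by standard (transfer; simp add: matrix_mul_assoc)+

end

lemma sl3_inverse [simp]:
  fixes A :: sl3
  shows "A * inverse A = 1" and "inverse A * A = 1"
  by (transfer; simp add: matrix_inv_SL)+

definition tr :: "sl3 \<Rightarrow> complex"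
  where "tr A = trace (Rep_sl3 A)"

lemma tr_commute: "tr (A * B) = tr (B * A)"
  unfolding tr_def times_sl3.rep_eq by (rule trace_mul_sym)

text \<open>
  A primed letter is the inverse of the unprimed one. Words need not be reduced: a word stands
  for the element of the free group that it represents.
\<close>

datatype letter = X1 | X1' | X2 | X2'

type_synonym word = "letter list"

text \<open>
  As the fundamental group of the surface is free on \<open>x\<^sub>1, x\<^sub>2\<close>, a representation is a pair of matrices.
\<close>

type_synonym rep = "sl3 \<times> sl3"

fun eval_letter :: "rep \<Rightarrow> letter \<Rightarrow> sl3" where
  "eval_letter (A, B) X1 = A"
| "eval_letter (A, B) X1' = inverse A"
| "eval_letter (A, B) X2 = B"
| "eval_letter (A, B) X2' = inverse B"

definition eval_word :: "rep \<Rightarrow> word \<Rightarrow> sl3"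
  where "eval_word \<rho> w = prod_list (map (eval_letter \<rho>) w)"

definition tr_word :: "word \<Rightarrow> rep \<Rightarrow> complex"
  where "tr_word w = (\<lambda>\<rho>. tr (eval_word \<rho> w))"

inductive_set regular_functions :: "(rep \<Rightarrow> complex) set" where
  const: "(\<lambda>\<rho>. c) \<in> regular_functions"
| entry1: "(\<lambda>\<rho>. Rep_sl3 (fst \<rho>) $ i $ j) \<in> regular_functions"
| entry2: "(\<lambda>\<rho>. Rep_sl3 (snd \<rho>) $ i $ j) \<in> regular_functions"
| add: "f \<in> regular_functions \<Longrightarrow> g \<in> regular_functions \<Longrightarrow> f + g \<in> regular_functions"
| mult: "f \<in> regular_functions \<Longrightarrow> g \<in> regular_functions \<Longrightarrow> f * g \<in> regular_functions"

text \<open>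
  The categorical quotient by simultaneous conjugation is the affine variety whose coordinate ring
  is the ring of invariant regular functions.
\<close>

definition coordinate_ring :: "(rep \<Rightarrow> complex) set" where
  "coordinate_ring = {f \<in> regular_functions.
     \<forall>C A B. f (C * A * inverse C, C * B * inverse C) = f (A, B)}"

text \<open>An endomorphism of the free group is given by the images of \<open>x\<^sub>1\<close> and \<open>x\<^sub>2\<close>.\<close>

type_synonym endo = "word \<times> word"

fun inverse_letter :: "letter \<Rightarrow> letter" where
  "inverse_letter X1 = X1'"
| "inverse_letter X1' = X1"
| "inverse_letter X2 = X2'"
| "inverse_letter X2' = X2"

definition inverse_word :: "word \<Rightarrow> word"
  where "inverse_word w = rev (map inverse_letter w)"

fun endo_letter :: "endo \<Rightarrow> letter \<Rightarrow> word" where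
  "endo_letter (u, v) X1 = u"
| "endo_letter (u, v) X1' = inverse_word u"
| "endo_letter (u, v) X2 = v"
| "endo_letter (u, v) X2' = inverse_word v"

definition endo_word :: "endo \<Rightarrow> word \<Rightarrow> word"
  where "endo_word \<sigma> w = concat (map (endo_letter \<sigma>) w)"

definition endo_comp :: "endo \<Rightarrow> endo \<Rightarrow> endo"  (infixr "\<circ>\<^sub>e" 70)
  where "\<sigma> \<circ>\<^sub>e \<tau> = (endo_word \<sigma> (fst \<tau>), endo_word \<sigma> (snd \<tau>))"

definition swap_aut :: endo
  where "swap_aut = ([X2], [X1])"

definition inv1_aut :: endo
  where "inv1_aut = ([X1'], [X2])"

definition inv_aut :: endo
  where "inv_aut = inv1_aut \<circ>\<^sub>e swap_aut \<circ>\<^sub>e inv1_aut \<circ>\<^sub>e swap_aut"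

lemma inv_aut_eq: "inv_aut = ([X1'], [X2'])"
  by (simp add: inv_aut_def endo_comp_def endo_word_def inv1_aut_def swap_aut_def inverse_word_def)

definition act :: "endo \<Rightarrow> (rep \<Rightarrow> complex) \<Rightarrow> (rep \<Rightarrow> complex)"
  where "act \<sigma> f = (\<lambda>\<rho>. f (eval_word \<rho> (fst \<sigma>), eval_word \<rho> (snd \<sigma>)))"

lemma eval_word_simps [simp]:
  "eval_word \<rho> [] = 1"
  "eval_word \<rho> (a # w) = eval_letter \<rho> a * eval_word \<rho> w"
  "eval_word \<rho> (v @ w) = eval_word \<rho> v * eval_word \<rho> w"
  by (simp_all add: eval_word_def)

lemma sl3_inverse_unique:
  fixes A B :: sl3
  assumes "A * B = 1"
  shows "inverse A = B"
  by (metis assms mult.assoc mult_1_left mult_1_right sl3_inverse(2))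

lemma eval_inverse_letter: "eval_letter \<rho> (inverse_letter a) = inverse (eval_letter \<rho> a)"
  by (cases \<rho>; cases a) (auto intro!: sl3_inverse_unique[symmetric])

lemma eval_inverse_word: "eval_word \<rho> (inverse_word w) = inverse (eval_word \<rho> w)"
proof (induction w)
  case Nil
  show ?case
    by (simp add: inverse_word_def sl3_inverse_unique)
next
  case (Cons a w)
  have "eval_letter \<rho> a * eval_word \<rho> w * (inverse (eval_word \<rho> w) * inverse (eval_letter \<rho> a)) = 1"
    by (metis mult.assoc mult_1_left sl3_inverse(1))
  then show ?case
    using Cons by (simp add: inverse_word_def eval_inverse_letter sl3_inverse_unique)
qed

lemma act_tr_word: "act \<sigma> (tr_word w) = tr_word (endo_word \<sigma> w)"
proof
  fix \<rho>
  have letter: "eval_word \<rho> (endo_letter \<sigma> a)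
      = eval_letter (eval_word \<rho> (fst \<sigma>), eval_word \<rho> (snd \<sigma>)) a" for a
    by (cases \<sigma>; cases a) (simp_all add: eval_inverse_word)
  have "eval_word \<rho> (endo_word \<sigma> w) = eval_word (eval_word \<rho> (fst \<sigma>), eval_word \<rho> (snd \<sigma>)) w"
    by (induction w) (simp_all add: endo_word_def letter)
  then show "act \<sigma> (tr_word w) \<rho> = tr_word (endo_word \<sigma> w) \<rho>"
    by (simp add: act_def tr_word_def)
qed

text \<open>\<open>Ti\<close> indexes \<open>t\<^bsub>(i)\<^esub>\<close> and \<open>Ti'\<close> indexes \<open>t\<^bsub>(-i)\<^esub>\<close>.\<close>

datatype gen = T1 | T1' | T2 | T2' | T3 | T3' | T4 | T4' | T5

lemma UNIV_gen: "(UNIV :: gen set) = {T1, T1', T2, T2', T3, T3', T4, T4', T5}"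
  by (auto intro: gen.exhaust)

instance gen :: finite
  by standard (simp add: UNIV_gen)

fun gen_word :: "gen \<Rightarrow> word" where
  "gen_word T1 = [X1]"
| "gen_word T1' = [X1']"
| "gen_word T2 = [X2]"
| "gen_word T2' = [X2']"
| "gen_word T3 = [X1, X2]"
| "gen_word T3' = [X1', X2']"
| "gen_word T4 = [X1, X2']"
| "gen_word T4' = [X1', X2]"
| "gen_word T5 = [X1, X2, X1', X2']"

definition t_gen :: "gen \<Rightarrow> rep \<Rightarrow> complex"
  where "t_gen g = tr_word (gen_word g)"

type_synonym poly9 = "(gen \<Rightarrow>\<^sub>0 nat) \<Rightarrow>\<^sub>0 complex"

definition var :: "gen \<Rightarrow> poly9"
  where "var g = Poly_Mapping.single (Poly_Mapping.single g 1) 1"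

definition pdiff :: "gen \<Rightarrow> poly9 \<Rightarrow> poly9" where
  "pdiff g p = (\<Sum>m\<in>Poly_Mapping.keys p. Poly_Mapping.single (m - Poly_Mapping.single g 1)
     (of_nat (Poly_Mapping.lookup m g) * Poly_Mapping.lookup p m))"

definition at_traces :: "poly9 \<Rightarrow> rep \<Rightarrow> complex" where
  "at_traces p = (\<lambda>\<rho>. \<Sum>m\<in>Poly_Mapping.keys p.
     Poly_Mapping.lookup p m * (\<Prod>g\<in>UNIV. t_gen g \<rho> ^ Poly_Mapping.lookup m g))"

abbreviation "t1 \<equiv> var T1"
abbreviation "t1' \<equiv> var T1'"
abbreviation "t2 \<equiv> var T2"
abbreviation "t2' \<equiv> var T2'"
abbreviation "t3 \<equiv> var T3"
abbreviation "t3' \<equiv> var T3'"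
abbreviation "t4 \<equiv> var T4"
abbreviation "t4' \<equiv> var T4'"
abbreviation "t5 \<equiv> var T5"

text \<open>
  In the coordinate ring these become the sum and the product of \<open>t\<^bsub>(5)\<^esub>\<close> and \<open>t\<^bsub>(-5)\<^esub>\<close>, the trace of the
  inverse commutator.
\<close>

definition P_poly :: poly9 where
  "P_poly =
     t1 * t1' * t2 * t2' - t1 * t2 * t3' - t1' * t2' * t3 - t1 * t2' * t4' - t1' * t2 * t4
     + t1 * t1' + t2 * t2' + t3 * t3' + t4 * t4' - 3"

definition Q_poly :: poly9 where
  "Q_poly =
     9 - 6 * t1 * t1' - 6 * t2 * t2' - 6 * t3 * t3' - 6 * t4 * t4' + t1^3 + t2^3 + t3^3
     + t4^3 + t1'^3 + t2'^3 + t3'^3 + t4'^3 - 3 * t4' * t3' * t1' - 3 * t4 * t3 * t1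
     - 3 * t4' * t2 * t3 - 3 * t4 * t2' * t3' + 3 * t4' * t2' * t1 + 3 * t4 * t2 * t1'
     + 3 * t1 * t2 * t3' + 3 * t1' * t2' * t3 + t2' * t1' * t2 * t1 + t3' * t2' * t3 * t2
     + t4' * t1' * t4 * t1 + t4' * t2' * t4 * t2 + t3' * t1' * t3 * t1
     + t3' * t4' * t3 * t4 + t4'^2 * t3' * t2' + t4^2 * t3 * t2 + t1'^2 * t2' * t4'
     + t1^2 * t2 * t4 + t1 * t2'^2 * t3' + t1' * t2^2 * t3 + t4' * t3' * t1^2
     + t4 * t3 * t1'^2 + t4' * t2 * t3'^2 + t4 * t2' * t3^2 + t1'^2 * t3' * t2
     + t1^2 * t3 * t2' + t4' * t1 * t2^2 + t4 * t1' * t2'^2 + t4' * t3 * t2'^2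
     + t4 * t3' * t2^2 + t1 * t3 * t4'^2 + t1' * t3' * t4^2 + t1' * t4' * t3^2
     + t1 * t4 * t3'^2 - 2 * t3'^2 * t2' * t1' - 2 * t3^2 * t2 * t1 - 2 * t4'^2 * t1' * t2
     - 2 * t4^2 * t1 * t2' + t1'^2 * t2'^2 * t3' + t1^2 * t2^2 * t3 + t4' * t1'^2 * t2^2
     + t4 * t1^2 * t2'^2 - t4' * t2'^2 * t2 * t1 - t4 * t2^2 * t2' * t1'
     - t3' * t1^2 * t1' * t2 - t3 * t1'^2 * t1 * t2' - t3' * t2^2 * t2' * t1
     - t3 * t2'^2 * t2 * t1' - t4' * t2' * t1' * t1^2 - t4 * t2 * t1 * t1'^2
     - t1' * t2'^3 * t1 - t1' * t2^3 * t1 - t1'^3 * t2' * t2 - t1^3 * t2' * t2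
     - t4' * t3' * t2' * t1' * t2 - t4 * t3 * t2 * t1 * t2' - t1' * t1 * t2 * t4' * t3
     - t1' * t1 * t2' * t4 * t3' + t2' * t1'^2 * t1^2 * t2 + t1' * t2'^2 * t2^2 * t1"

text \<open>
  \<open>W u v\<close> is the coefficient of \<open>\<partial>/\<partial>u \<and> \<partial>/\<partial>v\<close>, a sum over ordered pairs in
  which no antisymmetry of \<open>W\<close> is assumed. Sums and differences of bi-vector fields are pointwise.
\<close>

type_synonym bivector = "gen \<Rightarrow> gen \<Rightarrow> rep \<Rightarrow> complex"

definition wedge :: "(rep \<Rightarrow> complex) \<Rightarrow> gen \<Rightarrow> gen \<Rightarrow> bivector"
  where "wedge a u v = (\<lambda>k l. if k = u \<and> l = v then a else 0)"

fun inv_gen :: "gen \<Rightarrow> gen" where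
  "inv_gen T1 = T1'"
| "inv_gen T1' = T1"
| "inv_gen T2 = T2'"
| "inv_gen T2' = T2"
| "inv_gen T3 = T3'"
| "inv_gen T3' = T3"
| "inv_gen T4 = T4'"
| "inv_gen T4' = T4"
| "inv_gen T5 = T5"

lemma act_inv_aut_t_gen: "act inv_aut (t_gen g) = t_gen (inv_gen g)"
proof -
  have "tr (inverse A * (inverse B * (A * B))) = tr (A * (B * (inverse A * inverse B)))" for A B
    using tr_commute[of "inverse A * inverse B" "A * B"] by (simp add: mult.assoc)
  then show ?thesis
    unfolding t_gen_def act_tr_word
    by (cases g) (auto simp: inv_aut_eq endo_word_def inverse_word_def tr_word_def)
qed

lemma inv_gen_inv_gen [simp]: "inv_gen (inv_gen g) = g"
  by (cases g) simp_all

definition inv_bivector :: "bivector \<Rightarrow> bivector"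
  where "inv_bivector W = (\<lambda>k l. act inv_aut (W (inv_gen k) (inv_gen l)))"

lemma inv_bivector_wedge:
  "inv_bivector (wedge a u v) = wedge (act inv_aut a) (inv_gen u) (inv_gen v)"
  by (intro ext) (auto simp: inv_bivector_def wedge_def act_def)

text \<open>
  The functions \<open>at_traces F\<close> exhaust the coordinate ring, which is generated by the \<open>t_gen g\<close>;
  they are not free generators, so the partial derivatives are those of the polynomials \<open>F\<close>, \<open>G\<close>.
\<close>

definition has_bivector ::
  "((rep \<Rightarrow> complex) \<Rightarrow> (rep \<Rightarrow> complex) \<Rightarrow> (rep \<Rightarrow> complex)) \<Rightarrow> bivector \<Rightarrow> bool" where
  "has_bivector B W \<longleftrightarrow> (\<forall>F G. B (at_traces F) (at_traces G) =
     (\<Sum>u\<in>UNIV. \<Sum>v\<in>UNIV. W u v *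
       at_traces (pdiff u F * pdiff v G - pdiff v F * pdiff u G)))"

text \<open>
  The surface is a closed disc with two open discs removed. The loops \<open>x\<^sub>1, x\<^sub>2\<close> are based at \<open>0\<close>
  and run counterclockwise once around one hole each; they are freely homotopic to the two inner
  boundary circles, and \<open>x\<^sub>3 = (x\<^sub>2 x\<^sub>1)\<^sup>-\<^sup>1\<close> to the outer boundary circle run clockwise.
\<close>

definition pants :: "complex set"
  where "pants = cball 0 5 - ball (-2) 1 - ball 2 1"

fun letter_loop :: "letter \<Rightarrow> real \<Rightarrow> complex" where
  "letter_loop X1 = circlepath (-2) 2"
| "letter_loop X1' = reversepath (circlepath (-2) 2)"
| "letter_loop X2 = circlepath 2 (-2)"
| "letter_loop X2' = reversepath (circlepath 2 (-2))"

fun word_loop :: "word \<Rightarrow> real \<Rightarrow> complex" where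
  "word_loop [] = linepath 0 0"
| "word_loop (a # w) = letter_loop a +++ word_loop w"

definition represents :: "word \<Rightarrow> (real \<Rightarrow> complex) \<Rightarrow> bool"
  where "represents w \<gamma> \<longleftrightarrow> homotopic_loops pants \<gamma> (word_loop w)"

definition immersed_loop :: "(real \<Rightarrow> complex) \<Rightarrow> bool" where
  "immersed_loop \<gamma> \<longleftrightarrow> path_image \<gamma> \<subseteq> pants \<and> pathfinish \<gamma> = pathstart \<gamma> \<and>
     (\<exists>\<gamma>'. continuous_on {0..1} \<gamma>' \<and> \<gamma>' 0 = \<gamma>' 1 \<and>
       (\<forall>t\<in>{0..1}. (\<gamma> has_vector_derivative \<gamma>' t) (at t within {0..1}) \<and> \<gamma>' t \<noteq> 0))"

text \<open>The parameter at which a loop visits a point that it visits only once.\<close>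

definition time_at :: "(real \<Rightarrow> complex) \<Rightarrow> complex \<Rightarrow> real"
  where "time_at \<gamma> p = (THE t. t \<in> {0..<1} \<and> \<gamma> t = p)"

definition velocity_at :: "(real \<Rightarrow> complex) \<Rightarrow> complex \<Rightarrow> complex"
  where "velocity_at \<gamma> p = vector_derivative \<gamma> (at (time_at \<gamma> p) within {0..1})"

definition loop_at :: "(real \<Rightarrow> complex) \<Rightarrow> complex \<Rightarrow> real \<Rightarrow> complex"
  where "loop_at \<gamma> p = shiftpath (time_at \<gamma> p) \<gamma>"

definition intersections :: "(real \<Rightarrow> complex) \<Rightarrow> (real \<Rightarrow> complex) \<Rightarrow> complex set"
  where "intersections \<alpha> \<beta> = path_image \<alpha> \<inter> path_image \<beta>"

text \<open>
  The area spanned by the two velocities: its sign is the intersection number for the orientation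
  of the surface as a subset of the plane.
\<close>

definition cross_at :: "complex \<Rightarrow> (real \<Rightarrow> complex) \<Rightarrow> (real \<Rightarrow> complex) \<Rightarrow> real"
  where "cross_at p \<alpha> \<beta> = Im (cnj (velocity_at \<alpha> p) * velocity_at \<beta> p)"

definition generic_position :: "(real \<Rightarrow> complex) \<Rightarrow> (real \<Rightarrow> complex) \<Rightarrow> bool" where
  "generic_position \<alpha> \<beta> \<longleftrightarrow> immersed_loop \<alpha> \<and> immersed_loop \<beta> \<and>
     finite (intersections \<alpha> \<beta>) \<and>
     (\<forall>p\<in>intersections \<alpha> \<beta>. (\<exists>!t. t \<in> {0..<1} \<and> \<alpha> t = p) \<and> (\<exists>!t. t \<in> {0..<1} \<and> \<beta> t = p) \<and>
       cross_at p \<alpha> \<beta> \<noteq> 0)"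

text \<open>
  An orientation of the surface is a sign \<open>s\<close>: \<open>1\<close> is that of the plane, \<open>-1\<close> the opposite one.
\<close>

definition intersection_number ::
  "real \<Rightarrow> complex \<Rightarrow> (real \<Rightarrow> complex) \<Rightarrow> (real \<Rightarrow> complex) \<Rightarrow> real"
  where "intersection_number s p \<alpha> \<beta> = s * sgn (cross_at p \<alpha> \<beta>)"

text \<open>
  The orientation is singled out by the signs at the two intersections of a pair of curves; the
  two signs are exchanged when the orientation is reversed.
\<close>

definition standard_orientation :: "real \<Rightarrow> bool" where
  "standard_orientation s \<longleftrightarrow> s \<in> {1, -1} \<and>
     (\<exists>\<alpha> \<beta> p q. generic_position \<alpha> \<beta> \<and> represents [X1, X2'] \<alpha> \<and> represents [X2, X1'] \<beta> \<and>
       p \<noteq> q \<and> intersections \<alpha> \<beta> = {p, q} \<and>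
       represents [X2', X1, X2, X1'] (loop_at \<alpha> p +++ loop_at \<beta> p) \<and>
       represents [X1, X2', X1', X2] (loop_at \<alpha> q +++ loop_at \<beta> q) \<and>
       intersection_number s p \<alpha> \<beta> = -1 \<and> intersection_number s q \<alpha> \<beta> = 1)"

definition bilinear_on_coordinate_ring ::
  "((rep \<Rightarrow> complex) \<Rightarrow> (rep \<Rightarrow> complex) \<Rightarrow> (rep \<Rightarrow> complex)) \<Rightarrow> bool" where
  "bilinear_on_coordinate_ring B \<longleftrightarrow>
     (\<forall>f\<in>coordinate_ring. \<forall>g\<in>coordinate_ring. \<forall>h\<in>coordinate_ring. \<forall>c.
       B (f + g) h = B f h + B g h \<and> B h (f + g) = B h f + B h g \<and>
       B ((\<lambda>_. c) * f) h = (\<lambda>_. c) * B f h \<and> B h ((\<lambda>_. c) * f) = (\<lambda>_. c) * B h f)"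

text \<open>
  The words \<open>u, v, w p\<close> name the free homotopy classes of \<open>\<alpha>\<close>, \<open>\<beta>\<close> and
  \<open>\<alpha>\<^sub>p \<beta>\<^sub>p\<close>, whose traces in a representation are read off from the words.
\<close>

definition goldman_formula ::
  "real \<Rightarrow> ((rep \<Rightarrow> complex) \<Rightarrow> (rep \<Rightarrow> complex) \<Rightarrow> (rep \<Rightarrow> complex)) \<Rightarrow> bool" where
  "goldman_formula s B \<longleftrightarrow>
     (\<forall>\<alpha> \<beta> u v w. generic_position \<alpha> \<beta> \<and> represents u \<alpha> \<and> represents v \<beta> \<and>
       (\<forall>p\<in>intersections \<alpha> \<beta>. represents (w p) (loop_at \<alpha> p +++ loop_at \<beta> p)) \<longrightarrow>
       B (tr_word u) (tr_word v) = (\<lambda>\<rho>. \<Sum>p\<in>intersections \<alpha> \<beta>.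
         of_real (intersection_number s p \<alpha> \<beta>) *
           (tr_word (w p) \<rho> - 1/3 * tr_word u \<rho> * tr_word v \<rho>)))"

definition poisson_bracket ::
  "real \<Rightarrow> ((rep \<Rightarrow> complex) \<Rightarrow> (rep \<Rightarrow> complex) \<Rightarrow> (rep \<Rightarrow> complex)) \<Rightarrow> bool" where
  "poisson_bracket s B \<longleftrightarrow>
     (\<forall>f\<in>coordinate_ring. \<forall>g\<in>coordinate_ring. B f g \<in> coordinate_ring) \<and>
     bilinear_on_coordinate_ring B \<and>
     (\<forall>f\<in>coordinate_ring. \<forall>g\<in>coordinate_ring. B f g = - B g f) \<and>
     (\<forall>f\<in>coordinate_ring. \<forall>g\<in>coordinate_ring. \<forall>h\<in>coordinate_ring.
       B (f * g) h = f * B g h + g * B f h) \<and>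
     goldman_formula s B"

end

theory Submission
  imports Defs "HOL-Computational_Algebra.Fundamental_Theorem_Algebra"
begin

text \<open>
  Since the bracket is a biderivation, the chain rule expresses it on the whole coordinate ring by
  its values on pairs of generators, and a bi-vector field whose antisymmetrised coefficients are
  these values represents it (\<open>has_bivectorI\<close>). The values come from three sources.

  \<^item> The generators \<open>t\<^bsub>(\<plusminus>1)\<^esub>\<close>, \<open>t\<^bsub>(\<plusminus>2)\<^esub>\<close>, \<open>t\<^bsub>(\<plusminus>3)\<^esub>\<close> are traces of boundary curves or
    their inverses. These can be moved into
    a collar of the boundary, away from curves representing the generators other than \<open>t\<^bsub>(5)\<^esub>\<close>. As
    there are no intersections, the brackets vanish (\<open>goldman_peripheral\<close>).

  \<^item> The two intersections that fix the orientation of the surface give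
    \<open>{t\<^bsub>(4)\<^esub>, t\<^bsub>(-4)\<^esub>} = t\<^bsub>(-5)\<^esub> - t\<^bsub>(5)\<^esub> = P - 2 t\<^bsub>(5)\<^esub>\<close> (\<open>bracket_T4_T4'\<close>).

  \<^item> For brackets with \<open>t\<^bsub>(5)\<^esub>\<close>, no curve representing the commutator has to be drawn: applying the
    derivation \<open>{u, _}\<close> to the relation \<open>t\<^bsub>(5)\<^esub>\<^sup>2 - t\<^bsub>(5)\<^esub> P + Q = 0\<close> gives
    \<open>(2 t\<^bsub>(5)\<^esub> - P) {u, t\<^bsub>(5)\<^esub>} = - \<Sum> \<partial>(Q - t\<^bsub>(5)\<^esub> P)/\<partial>g {u, g}\<close>, the sum being over the
    other eight generators \<open>g\<close>, of which only \<open>t\<^bsub>(\<plusminus>4)\<^esub>\<close> contribute. The right-hand side is a multiple of \<open>2 t\<^bsub>(5)\<^esub> - P\<close> by the second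
    item, and this factor may be cancelled, because it does not vanish identically and regular
    functions on pairs of matrices form an integral domain (\<open>regular_zero_divisor\<close>).

  The relation says that \<open>P\<close> and \<open>Q\<close> are the sum and the product of the traces of the commutator and
  of its inverse. An identity of invariant regular functions may be checked where the first matrix
  has distinct eigenvalues, hence where it is diagonal (\<open>eq_if_eq_on_diagonal\<close>). There all traces are
  polynomials in a few invariants of the second matrix, and the two commutator traces are exchanged
  by swapping the two products along 3-cycles of its off-diagonal entries
  (\<open>diagonal_trace_identities\<close>).
\<close>

section \<open>Calculus in the polynomial ring of the generators\<close>

definition insertion :: "(gen \<Rightarrow> complex) \<Rightarrow> poly9 \<Rightarrow> complex" where
  "insertion x p = (\<Sum>m\<in>Poly_Mapping.keys p.
     Poly_Mapping.lookup p m * (\<Prod>g\<in>UNIV. x g ^ Poly_Mapping.lookup m g))"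

lemma at_traces_insertion: "at_traces p \<rho> = insertion (\<lambda>g. t_gen g \<rho>) p"
  by (simp add: at_traces_def insertion_def)

text \<open>
  Evaluation and partial differentiation are both sums over the support of a polynomial. Enlarging
  the supports of both summands to their union makes the additivity visible.
\<close>

lemma sum_keys_add:
  fixes \<phi> :: "'m \<Rightarrow> 'a::comm_monoid_add \<Rightarrow> 'b::comm_monoid_add"
  assumes add: "\<And>m a b. \<phi> m (a + b) = \<phi> m a + \<phi> m b" and zero: "\<And>m. \<phi> m 0 = 0"
  shows "(\<Sum>m\<in>Poly_Mapping.keys (p + q). \<phi> m (Poly_Mapping.lookup (p + q) m))
    = (\<Sum>m\<in>Poly_Mapping.keys p. \<phi> m (Poly_Mapping.lookup p m))
      + (\<Sum>m\<in>Poly_Mapping.keys q. \<phi> m (Poly_Mapping.lookup q m))"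
proof -
  let ?K = "Poly_Mapping.keys p \<union> Poly_Mapping.keys q"
  have *: "(\<Sum>m\<in>Poly_Mapping.keys r. \<phi> m (Poly_Mapping.lookup r m))
      = (\<Sum>m\<in>?K. \<phi> m (Poly_Mapping.lookup r m))"
    if "Poly_Mapping.keys r \<subseteq> ?K" for r
    using that by (intro sum.mono_neutral_left) (auto simp: in_keys_iff zero)
  have "(\<Sum>m\<in>Poly_Mapping.keys (p + q). \<phi> m (Poly_Mapping.lookup (p + q) m))
      = (\<Sum>m\<in>?K. \<phi> m (Poly_Mapping.lookup (p + q) m))"
    by (rule *[OF Poly_Mapping.keys_add])
  then show ?thesis
    by (simp only: *[OF Un_upper1] *[OF Un_upper2] lookup_add add sum.distrib)
qed

lemma insertion_add [simp]: "insertion x (p + q) = insertion x p + insertion x q"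
  unfolding insertion_def by (rule sum_keys_add) (simp_all add: algebra_simps)

lemma pdiff_add [simp]: "pdiff g (p + q) = pdiff g p + pdiff g q"
  unfolding pdiff_def by (rule sum_keys_add) (simp_all add: algebra_simps single_add)

lemma insertion_single:
  "insertion x (Poly_Mapping.single m c) = c * (\<Prod>g\<in>UNIV. x g ^ Poly_Mapping.lookup m g)"
  by (cases "c = 0") (simp_all add: insertion_def)

lemma pdiff_single:
  "pdiff g (Poly_Mapping.single m c) = Poly_Mapping.single (m - Poly_Mapping.single g 1)
     (of_nat (Poly_Mapping.lookup m g) * c)"
  by (cases "c = 0") (simp_all add: pdiff_def)

lemma insertion_0 [simp]: "insertion x 0 = 0" and pdiff_0 [simp]: "pdiff g 0 = 0"
  by (simp_all add: insertion_def pdiff_def)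

lemma insertion_uminus [simp]: "insertion x (- p) = - insertion x p"
  using insertion_add[of x "- p" p] by (simp add: eq_neg_iff_add_eq_0)

lemma pdiff_uminus [simp]: "pdiff g (- p) = - pdiff g p"
  using pdiff_add[of g "- p" p] by (simp add: eq_neg_iff_add_eq_0)

lemma insertion_diff [simp]: "insertion x (p - q) = insertion x p - insertion x q"
  using insertion_add[of x p "- q"] by simp

lemma pdiff_diff [simp]: "pdiff g (p - q) = pdiff g p - pdiff g q"
  using pdiff_add[of g p "- q"] by simp

lemma poly9_single_induct [case_names single add]:
  fixes p :: poly9
  assumes single: "\<And>m c. R (Poly_Mapping.single m c)" and add: "\<And>p q. R p \<Longrightarrow> R q \<Longrightarrow> R (p + q)"
  shows "R p"
proof (induction p rule: update_induct)
  case const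
  then show ?case using single[of 0 0] by simp
next
  case (update f m c)
  have "Poly_Mapping.update m c f = f + Poly_Mapping.single m c"
    using update(1) by (intro poly_mapping_eqI)
      (auto simp: lookup_update lookup_add lookup_single in_keys_iff when_def)
  then show ?case using add[OF update(3) single] by simp
qed

lemma insertion_mult [simp]: "insertion x (p * q) = insertion x p * insertion x q"
proof (induction p rule: poly9_single_induct)
  case (single m c)
  show ?case
    by (induction q rule: poly9_single_induct)
      (simp_all add: mult_single insertion_single lookup_add power_add prod.distrib algebra_simps)
qed (simp add: algebra_simps)

lemma pdiff_mult [simp]: "pdiff g (p * q) = pdiff g p * q + p * pdiff g q"
proof (induction p rule: poly9_single_induct)
  case (single m c)
  show ?case
  proof (induction q rule: poly9_single_induct)
    case (single n d)
    \<comment> \<open>Exponents are subtracted in the natural numbers; a monomial without the variable \<open>g\<close> is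
      harmless, since its derivative has coefficient 0.\<close>
    have shift: "m + n - Poly_Mapping.single g 1 = m - Poly_Mapping.single g 1 + n"
      if "Poly_Mapping.lookup m g \<noteq> 0" for m n :: "gen \<Rightarrow>\<^sub>0 nat"
      using that by (intro poly_mapping_eqI) (auto simp: lookup_add lookup_minus lookup_single when_def)
    show ?case
      using shift[of m n] shift[of n m]
      by (cases "Poly_Mapping.lookup m g = 0"; cases "Poly_Mapping.lookup n g = 0")
        (simp_all add: mult_single pdiff_single lookup_add single_add[symmetric] algebra_simps)
  qed (simp add: algebra_simps)
qed (simp add: algebra_simps)

lemma insertion_const [simp]: "insertion x (Poly_Mapping.single 0 c) = c"
  and pdiff_const [simp]: "pdiff g (Poly_Mapping.single 0 c) = 0"
  by (simp_all add: insertion_single pdiff_single)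

lemma insertion_1 [simp]: "insertion x 1 = 1" and pdiff_1 [simp]: "pdiff g 1 = 0"
  using insertion_const[of x 1] pdiff_const[of g 1] by simp_all

lemma insertion_numeral [simp]: "insertion x (numeral k) = numeral k"
  and pdiff_numeral [simp]: "pdiff g (numeral k) = 0"
  using insertion_const[of x "numeral k"] pdiff_const[of g "numeral k"] by simp_all

lemma insertion_power [simp]: "insertion x (p ^ n) = insertion x p ^ n"
  by (induction n) simp_all

lemma insertion_var [simp]: "insertion x (var g) = x g"
proof -
  have "(\<Prod>h\<in>UNIV. x h ^ Poly_Mapping.lookup (Poly_Mapping.single g (1::nat)) h)
      = (\<Prod>h\<in>UNIV. if h = g then x h else 1)"
    by (intro prod.cong) (auto simp: lookup_single when_def)
  then show ?thesis
    by (simp add: var_def insertion_single)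
qed

lemma pdiff_var [simp]: "pdiff g (var h) = (if g = h then 1 else 0)"
  by (simp add: var_def pdiff_single lookup_single when_def)

text \<open>
  The polynomial ring is generated by constants and variables, so that properties of homomorphisms
  and derivations need only be checked on these.
\<close>

lemma poly9_induct [case_names const var add mult]:
  fixes p :: poly9
  assumes const: "\<And>c. R (Poly_Mapping.single 0 c)" and var: "\<And>g. R (var g)"
    and add: "\<And>p q. R p \<Longrightarrow> R q \<Longrightarrow> R (p + q)" and mult: "\<And>p q. R p \<Longrightarrow> R q \<Longrightarrow> R (p * q)"
  shows "R p"
proof (induction p rule: poly9_single_induct)
  case (single m c)
  show ?case
  proof (induction m rule: update_induct)
    case const
    show ?case using assms(1) by simp
  next
    case (update m g n)
    have "Poly_Mapping.update g n m = m + Poly_Mapping.single g n"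
      using update(1) by (intro poly_mapping_eqI)
        (auto simp: lookup_update lookup_add lookup_single in_keys_iff when_def)
    moreover have "R (Poly_Mapping.single (m + Poly_Mapping.single g n) c)" for n
    proof (induction n)
      case 0
      then show ?case using update by simp
    next
      case (Suc n)
      have "Poly_Mapping.single (m + Poly_Mapping.single g (Suc n)) c
          = Poly_Mapping.single (m + Poly_Mapping.single g n) c * var g"
        by (simp add: var_def mult_single add.assoc single_add[symmetric])
      then show ?case using mult[OF Suc var] by simp
    qed
    ultimately show ?case by simp
  qed
qed (rule add)

lemma pdiff_power [simp]: "pdiff g (p ^ n) = of_nat n * p ^ (n - 1) * pdiff g p"
proof (induction n)
  case (Suc n)
  then show ?case by (cases n) (simp_all add: algebra_simps)
qed simp

lemma pdiff_T5_P: "pdiff T5 P_poly = 0" and pdiff_T5_Q: "pdiff T5 Q_poly = 0"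
  by (simp_all add: P_poly_def Q_poly_def)

text \<open>
  The polynomials \<open>P\<close> and \<open>Q\<close> are symmetric under the exchange of all \<open>t\<^bsub>(i)\<^esub>\<close> with \<open>t\<^bsub>(-i)\<^esub>\<close>. This exchange
  therefore turns the derivative with respect to \<open>t\<^bsub>(-4)\<^esub>\<close> into the one with respect to \<open>t\<^bsub>(4)\<^esub>\<close>.
\<close>

lemma insertion_inv_gen_pdiff:
  "insertion (x \<circ> inv_gen) (pdiff T4' (Q_poly - t5 * P_poly))
    = insertion x (pdiff T4 (Q_poly - t5 * P_poly))"
  by (simp add: P_poly_def Q_poly_def)

section \<open>Loops in the pair of pants\<close>

text \<open>
  All curves below consist of such circles; \<open>k\<close> is \<open>1\<close> or \<open>-1\<close> and gives the direction.
\<close>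

definition circle_loop :: "complex \<Rightarrow> complex \<Rightarrow> real \<Rightarrow> real \<Rightarrow> complex" where
  "circle_loop c z k t = c + z * cis (2 * pi * k * t)"

lemma in_pants_iff: "w \<in> pants \<longleftrightarrow> cmod w \<le> 5 \<and> 1 \<le> cmod (w + 2) \<and> 1 \<le> cmod (w - 2)"
  by (auto simp: pants_def dist_norm norm_minus_commute add.commute)

lemma in_sphere_iff:
  fixes w :: complex
  shows "w \<in> sphere (-2) r \<longleftrightarrow> cmod (w + 2) = r" "w \<in> sphere 2 r \<longleftrightarrow> cmod (w - 2) = r"
    "w \<in> sphere 0 r \<longleftrightarrow> cmod w = r"
  by (auto simp: dist_norm norm_minus_commute add.commute)

text \<open>
  The triangle inequalities between the centre of the outer circle and the centres of the two holes,
  which lie at distance 4 from each other, settle all questions of containment and disjointness.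
\<close>

lemma triangle_centres:
  "cmod w \<le> cmod (w - 2) + 2" "cmod w \<le> cmod (w + 2) + 2" "4 \<le> cmod (w - 2) + cmod (w + 2)"
  using norm_triangle_ineq[of "w - 2" 2] norm_triangle_ineq[of "w + 2" "-2"]
    norm_triangle_ineq4[of "w + 2" "w - 2"] by auto

lemma sphere_subset_pants:
  assumes "1 \<le> r" "r \<le> 2"
  shows "sphere (-2) r \<subseteq> pants" "sphere 2 r \<subseteq> pants" "sphere 0 (6 - r) \<subseteq> pants"
  unfolding subset_iff in_sphere_iff in_pants_iff
  using assms triangle_centres by (smt (verit))+

lemma cis_full_turn: "k \<in> {1, -1} \<Longrightarrow> cis (2 * pi * k) = 1"
  by (auto simp: complex_eq_iff)

lemma letter_loop_circle_loop:
  "letter_loop X1 = circle_loop (-2) 2 1" "letter_loop X1' = circle_loop (-2) 2 (-1)"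
  "letter_loop X2 = circle_loop 2 (-2) 1" "letter_loop X2' = circle_loop 2 (-2) (-1)"
proof -
  have e: "exp (2 * complex_of_real pi * \<i> * complex_of_real t) = cis (2 * pi * t)" for t
    by (simp add: cis_conv_exp algebra_simps)
  have *: "circlepath c r = circle_loop c (of_real r) 1" for c r
    by (rule ext) (simp add: circlepath circle_loop_def e)
  have **: "reversepath (circlepath c r) = circle_loop c (of_real r) (-1)" for c r
  proof (rule ext)
    fix t
    have "cis (2 * pi * (1 - t)) = cis (2 * pi) * cis (- (2 * pi * t))"
      by (simp add: cis_mult algebra_simps)
    then show "reversepath (circlepath c r) t = circle_loop c (of_real r) (-1) t"
      by (simp add: reversepath_def circlepath circle_loop_def e cis_full_turn[of 1, simplified])
  qed
  show "letter_loop X1 = circle_loop (-2) 2 1" "letter_loop X1' = circle_loop (-2) 2 (-1)"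
    "letter_loop X2 = circle_loop 2 (-2) 1" "letter_loop X2' = circle_loop 2 (-2) (-1)"
    using *[of _ 2] *[of _ "-2"] **[of _ 2] **[of _ "-2"] by simp_all
qed

lemma path_circle_loop [simp]: "path (circle_loop c z k)"
  unfolding path_def circle_loop_def by (intro continuous_intros)

lemma pathstart_circle_loop [simp]: "pathstart (circle_loop c z k) = c + z"
  by (simp add: pathstart_def circle_loop_def)

lemma pathfinish_circle_loop [simp]: "k \<in> {1, -1} \<Longrightarrow> pathfinish (circle_loop c z k) = c + z"
  using cis_full_turn[of k] by (simp add: pathfinish_def circle_loop_def)

lemma path_image_circle_loop: "path_image (circle_loop c z k) \<subseteq> sphere c (cmod z)"
  by (auto simp: path_image_def circle_loop_def dist_norm norm_mult norm_minus_commute)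

lemma circle_loop_has_vector_derivative:
  "((\<lambda>t. circle_loop c z k (m * t + d)) has_vector_derivative
     (m * (2 * pi * k)) *\<^sub>R (\<i> * z * cis (2 * pi * k * (m * t + d)))) (at t within T)"
  unfolding circle_loop_def has_vector_derivative_def
  by (rule derivative_eq_intros refl | simp)+ (auto simp: fun_eq_iff scaleR_conv_of_real algebra_simps)

lemma immersed_circle_loop:
  assumes "k \<in> {1, -1}" "z \<noteq> 0" "sphere c (cmod z) \<subseteq> pants"
  shows "immersed_loop (circle_loop c z k)"
proof -
  let ?v = "\<lambda>t. (1 * (2 * pi * k)) *\<^sub>R (\<i> * z * cis (2 * pi * k * (1 * t + 0)))"
  have "continuous_on {0..1} ?v" by (intro continuous_intros)
  moreover have "?v 0 = ?v 1" using cis_full_turn[OF assms(1)] by simp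
  moreover have "(circle_loop c z k has_vector_derivative ?v t) (at t within {0..1}) \<and> ?v t \<noteq> 0" for t
    using circle_loop_has_vector_derivative[of c z k 1 0 t "{0..1}"] assms by auto
  ultimately show ?thesis
    unfolding immersed_loop_def using assms path_image_circle_loop[of c z k] by auto
qed

text \<open>
  The circles around the two holes touch at \<open>0\<close>. Run through in opposite directions, they have the same
  velocity there, so that the concatenation is continuously differentiable. This gives immersed
  curves for \<open>x\<^sub>1 x\<^sub>2\<^sup>-\<^sup>1\<close> and \<open>x\<^sub>1\<^sup>-\<^sup>1 x\<^sub>2\<close>; the concatenations for \<open>x\<^sub>1 x\<^sub>2\<close> and \<open>x\<^sub>1\<^sup>-\<^sup>1 x\<^sub>2\<^sup>-\<^sup>1\<close> have a cusp.
\<close>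

lemma immersed_figure_eight:
  assumes k: "k \<in> {1, -1}"
  shows "immersed_loop (circle_loop (-2) 2 k +++ circle_loop 2 (-2) (-k))"
proof -
  let ?p = "\<lambda>t. circle_loop (-2) 2 k (2 * t + 0)" and ?q = "\<lambda>t. circle_loop 2 (-2) (-k) (2 * t + (-1))"
  let ?v = "\<lambda>t. (2 * (2 * pi * k)) *\<^sub>R (\<i> * 2 * cis (2 * pi * k * (2 * t + 0)))"
  let ?w = "\<lambda>t. (2 * (2 * pi * (-k))) *\<^sub>R (\<i> * (-2) * cis (2 * pi * (-k) * (2 * t + (-1))))"
  let ?\<gamma> = "\<lambda>t. if t \<in> {0..1/2} then ?p t else ?q t" and ?\<delta> = "\<lambda>t. if t \<in> {0..1/2} then ?v t else ?w t"
  have full: "cis (2 * pi * k) = 1" "cis (- (2 * pi * k)) = 1"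
    using cis_full_turn[of k] cis_full_turn[of "-k"] k by auto
  have split: "{0..1} = {0..1/2} \<union> {1/2..1::real}" by auto
  have cont: "continuous_on {0..1} ?\<delta>"
    unfolding split
  proof (rule continuous_on_cases)
    show "continuous_on {0..1/2} ?v" "continuous_on {1/2..1} ?w" by (intro continuous_intros)+
    have "t = 1/2" if "(t \<in> {0..1/2} \<and> t \<notin> {0..1/2}) \<or> (t \<in> {1/2..1} \<and> t \<in> {0..1/2})" for t :: real
      using that by auto
    then show "\<forall>t. (t \<in> {0..1/2} \<and> t \<notin> {0..1/2}) \<or> (t \<in> {1/2..1} \<and> t \<in> {0..1/2}) \<longrightarrow> ?v t = ?w t"
      using full by fastforce
  qed simp_all
  have closed: "?\<delta> 0 = ?\<delta> 1" by (simp add: full)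
  have d: "(?\<gamma> has_vector_derivative ?\<delta> t) (at t within {0..1})" if t: "t \<in> {0..1}" for t
  proof (rule has_vector_derivative_If_within_closures[OF _ split])
    show "t \<in> {0..1/2} \<union> {1/2..1}" using t split by simp
    show "(?p has_vector_derivative ?v t) (at t within {0..1/2} \<union> (closure {0..1/2} \<inter> closure {1/2..1}))"
      by (rule circle_loop_has_vector_derivative)
    show "(?q has_vector_derivative ?w t) (at t within {1/2..1} \<union> (closure {0..1/2} \<inter> closure {1/2..1}))"
      by (rule circle_loop_has_vector_derivative)
    assume "t \<in> closure {0..1/2}" "t \<in> closure {1/2..1}"
    then have "t = 1/2" by simp
    moreover have "?p (1/2) = ?q (1/2)" "?v (1/2) = ?w (1/2)" using full by (simp_all add: circle_loop_def)
    ultimately show "?p t = ?q t" "?v t = ?w t" by (simp_all only:)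
  qed
  have deriv: "((circle_loop (-2) 2 k +++ circle_loop 2 (-2) (-k)) has_vector_derivative ?\<delta> t)
      (at t within {0..1})"
    if t: "t \<in> {0..1}" for t
    by (rule has_vector_derivative_transform[OF t _ d[OF t]]) (simp add: joinpaths_def)
  have nz: "?\<delta> t \<noteq> 0" for t using k by auto
  have "sphere (-2) 2 \<union> sphere 2 2 \<subseteq> pants"
    using sphere_subset_pants[of 2] by simp
  moreover have "path_image (circle_loop (-2) 2 k) \<subseteq> sphere (-2) 2"
    "path_image (circle_loop 2 (-2) (-k)) \<subseteq> sphere 2 2"
    using path_image_circle_loop[of "-2" 2 k] path_image_circle_loop[of 2 "-2" "-k"] by simp_all
  ultimately have "path_image (circle_loop (-2) 2 k +++ circle_loop 2 (-2) (-k)) \<subseteq> pants"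
    using path_image_join_subset[of "circle_loop (-2) 2 k" "circle_loop 2 (-2) (-k)"] by blast
  moreover have "pathfinish (circle_loop (-2) 2 k +++ circle_loop 2 (-2) (-k))
      = pathstart (circle_loop (-2) 2 k +++ circle_loop 2 (-2) (-k))"
    using k pathfinish_circle_loop[of "-k"] by auto
  ultimately show ?thesis
    unfolding immersed_loop_def using cont closed deriv nz by blast
qed

text \<open>
  The generators that are traces of boundary curves or of their inverses; note that \<open>x\<^sub>1 x\<^sub>2\<close> is conjugate to
  \<open>x\<^sub>2 x\<^sub>1 = x\<^sub>3\<^sup>-\<^sup>1\<close>.
\<close>

definition peripheral :: "gen set" where "peripheral = {T1, T1', T2, T2', T3, T3'}"

text \<open>
  The parameter \<open>r\<close> moves a boundary circle into the interior: \<open>r = 1\<close> is the boundary itself, and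
  curves for distinct \<open>r\<close> close to \<open>1\<close> are disjoint, even if they are parallel to the same boundary
  component. The outer circle starts on the imaginary axis, so that its left half lies next to the
  circle around the left hole in the straight-line homotopy to \<open>x\<^sub>1 x\<^sub>2\<close>.
\<close>

fun rim :: "gen \<Rightarrow> real \<Rightarrow> real \<Rightarrow> complex" where
  "rim T1 r = circle_loop (-2) (of_real r) 1"
| "rim T1' r = circle_loop (-2) (of_real r) (-1)"
| "rim T2 r = circle_loop 2 (- of_real r) 1"
| "rim T2' r = circle_loop 2 (- of_real r) (-1)"
| "rim T3 r = circle_loop 0 (of_real (6 - r) * \<i>) 1"
| "rim T3' r = circle_loop 0 (- of_real (6 - r) * \<i>) (-1)"
| "rim _ r = undefined"

lemma immersed_rim:
  assumes "g \<in> peripheral" "1 \<le> r" "r \<le> 2"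
  shows "immersed_loop (rim g r)"
proof -
  have "cmod (complex_of_real r) = r" "cmod (6 - complex_of_real r) = 6 - r"
    "cmod (complex_of_real r - 6) = 6 - r" "complex_of_real r \<noteq> 0" "complex_of_real r \<noteq> 6"
    using assms norm_of_real[of "6 - r", where 'a=complex] norm_of_real[of "r - 6", where 'a=complex] by auto
  then show ?thesis
    using assms(1) sphere_subset_pants[OF assms(2,3)]
    unfolding peripheral_def
    by (elim insertE emptyE) (simp_all add: norm_mult immersed_circle_loop)
qed

lemma path_image_letter_loop: "path_image (letter_loop a) \<subseteq> sphere (-2) 2 \<union> sphere 2 2"
proof -
  have "path_image (circle_loop (-2) 2 k) \<subseteq> sphere (-2) 2"
     "path_image (circle_loop 2 (-2) k) \<subseteq> sphere 2 2" for k
    using path_image_circle_loop[of "-2" 2 k] path_image_circle_loop[of 2 "-2" k] by simp_all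
  then show ?thesis
    by (cases a; simp only: letter_loop_circle_loop; blast)
qed

lemma letter_loop_simps:
  "path (letter_loop a)" "pathstart (letter_loop a) = 0" "pathfinish (letter_loop a) = 0"
  "path_image (letter_loop a) \<subseteq> pants"
proof -
  show "path (letter_loop a)" "pathstart (letter_loop a) = 0" "pathfinish (letter_loop a) = 0"
    by (cases a; simp only: letter_loop_circle_loop; simp)+
  show "path_image (letter_loop a) \<subseteq> pants"
    using path_image_letter_loop[of a] sphere_subset_pants[of 2] by auto
qed

lemma homotopic_letter_linepath: "homotopic_paths pants (letter_loop a +++ linepath 0 0) (letter_loop a)"
  by (rule homotopic_paths_rid') (simp_all add: letter_loop_simps)

lemma represents_letter:
  assumes "homotopic_loops pants \<gamma> (letter_loop a)"
  shows "represents [a] \<gamma>"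
  unfolding represents_def word_loop.simps
  by (rule homotopic_loops_trans[OF assms
      homotopic_paths_imp_homotopic_loops[OF homotopic_paths_sym[OF homotopic_letter_linepath]]])
     (simp_all add: letter_loop_simps)

lemma represents_two_letters:
  assumes "homotopic_loops pants \<gamma> (letter_loop a +++ letter_loop b)"
  shows "represents [a, b] \<gamma>"
proof -
  have "homotopic_paths pants (letter_loop a +++ letter_loop b +++ linepath 0 0)
      (letter_loop a +++ letter_loop b)"
    by (rule homotopic_paths_join[OF _ homotopic_letter_linepath]) (simp_all add: letter_loop_simps)
  then have "homotopic_loops pants (letter_loop a +++ letter_loop b) (word_loop [a, b])"
    by (intro homotopic_paths_imp_homotopic_loops[OF homotopic_paths_sym]) (simp_all add: letter_loop_simps)
  then show ?thesis
    unfolding represents_def by (rule homotopic_loops_trans[OF assms])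
qed

lemma homotopic_concentric:
  assumes "1 \<le> r" "r \<le> 2" "c \<in> {-2, 2}" "k \<in> {1, -1}" "e \<in> {1, -1}"
  shows "homotopic_loops pants (circle_loop c (e * of_real r) k) (circle_loop c (e * 2) k)"
proof (rule homotopic_loops_linear)
  fix t x :: real
  show "closed_segment (circle_loop c (e * of_real r) k t) (circle_loop c (e * 2) k t) \<subseteq> pants"
  proof
    fix w assume "w \<in> closed_segment (circle_loop c (e * of_real r) k t) (circle_loop c (e * 2) k t)"
    then obtain u where u: "0 \<le> u" "u \<le> 1" and
      w: "w = (1 - u) *\<^sub>R circle_loop c (e * of_real r) k t + u *\<^sub>R circle_loop c (e * 2) k t"
      by (auto simp: in_segment)
    define \<rho> where "\<rho> = (1 - u) * r + u * 2"
    have "w - c = of_real \<rho> * (e * cis (2 * pi * k * t))"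
      by (simp add: w circle_loop_def \<rho>_def scaleR_conv_of_real algebra_simps)
    moreover have "1 \<le> \<rho>" "\<rho> \<le> 2"
      using u assms mult_left_mono[of 1 r "1 - u"] mult_left_mono[of r 2 "1 - u"]
      by (auto simp: \<rho>_def algebra_simps)
    moreover have "cmod e = 1" using assms by auto
    ultimately have "cmod (w - c) = \<rho>" by (simp add: norm_mult)
    then show "w \<in> pants"
      using sphere_subset_pants[OF \<open>1 \<le> \<rho>\<close> \<open>\<rho> \<le> 2\<close>] assms(3)
      by (auto simp: subset_iff in_sphere_iff simp del: mem_sphere)
  qed
qed (use assms in simp_all)

text \<open>
  Both ends lie in the half-plane with inner normal \<open>e\<close> at distance \<open>r\<close> from \<open>c\<close>, hence so does the
  segment.
\<close>

lemma half_plane_norm: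
  assumes "w \<in> closed_segment p q" "cmod e = 1" "r \<le> Re (cnj e * (p - c))" "r \<le> Re (cnj e * (q - c))"
  shows "r \<le> cmod (w - c)"
proof -
  obtain u where u: "0 \<le> u" "u \<le> 1" and w: "w = (1 - u) *\<^sub>R p + u *\<^sub>R q"
    using assms(1) by (auto simp: in_segment)
  have "r = (1 - u) * r + u * r" by (simp add: algebra_simps)
  also have "\<dots> \<le> (1 - u) * Re (cnj e * (p - c)) + u * Re (cnj e * (q - c))"
    using u assms by (intro add_mono mult_left_mono) auto
  also have "\<dots> = Re (cnj e * (w - c))"
    by (simp add: w algebra_simps)
  also have "\<dots> \<le> cmod (cnj e * (w - c))" by (rule complex_Re_le_cmod)
  finally show ?thesis by (simp add: norm_mult assms)
qed

text \<open>
  The straight-line homotopy from the left half of the outer circle to the circle around the left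
  hole avoids both holes. Seen from \<open>-2\<close>, the direction of the inner point is \<open>cis (2 \<theta>)\<close>, and the
  component of the outer point in this direction is \<open>2 + s (6 - r - 4 s) \<ge> 2\<close> with
  \<open>s = \<bar>sin \<theta>\<bar> \<le> 1\<close>. The right hole is avoided because both ends have real part at most \<open>0\<close>.
\<close>

lemma segment_outer_inner:
  assumes k: "k \<in> {1, -1}" and r: "1 \<le> r" "r \<le> 2" and t: "0 \<le> t" "t \<le> 1/2"
  shows "closed_segment (circle_loop 0 (of_real (k * (6 - r)) * \<i>) k t) (circle_loop (-2) 2 k (2 * t))
      \<subseteq> pants" (is "closed_segment ?p ?q \<subseteq> _")
proof
  fix w assume w: "w \<in> closed_segment ?p ?q"
  define \<theta> s where "\<theta> = 2 * pi * k * t" and "s = sin (2 * pi * t)"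
  have p: "?p = of_real (k * (6 - r)) * \<i> * cis \<theta>" and q: "?q = -2 + 2 * cis (2 * \<theta>)"
    by (simp_all add: circle_loop_def \<theta>_def mult_ac)
  have s: "0 \<le> s" "s \<le> 1" unfolding s_def using t by (auto intro: sin_ge_zero)
  have ks: "k * sin \<theta> = s" using k by (auto simp: s_def \<theta>_def)
  have "(sin \<theta>)^2 = s^2" using k by (auto simp: s_def \<theta>_def)
  then have c2: "cos (2 * \<theta>) = 1 - 2 * s^2" by (simp add: cos_double_sin)
  have "?p \<in> cball 0 5" "?q \<in> cball 0 5"
    using r k norm_of_real[of "6 - r", where 'a=complex] norm_triangle_ineq[of "-2" "2 * cis (2 * \<theta>)"]
    unfolding p q by (auto simp: norm_mult simp flip: of_real_diff)
  then have "w \<in> cball 0 5"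
    using w convex_contains_segment[of "cball (0::complex) 5"] by (meson convex_cball subset_iff)
  moreover have "2 \<le> cmod (w - (-2))"
  proof (rule half_plane_norm[OF w, of "cis (2 * \<theta>)"])
    have "Re (cnj (cis (2 * \<theta>)) * (?p - (-2)))
        = 2 * cos (2 * \<theta>) + k * (6 - r) * (sin (2 * \<theta>) * cos \<theta> - cos (2 * \<theta>) * sin \<theta>)"
      unfolding p by (simp add: algebra_simps)
    also have "sin (2 * \<theta>) * cos \<theta> - cos (2 * \<theta>) * sin \<theta> = sin \<theta>"
      by (simp flip: sin_diff)
    also have "2 * cos (2 * \<theta>) + k * (6 - r) * sin \<theta> = 2 * (1 - 2 * s^2) + (6 - r) * (k * sin \<theta>)"
      unfolding c2 by simp
    also have "\<dots> = 2 + s * ((6 - r) - 4 * s)"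
      unfolding ks by (simp add: algebra_simps power2_eq_square)
    finally show "2 \<le> Re (cnj (cis (2 * \<theta>)) * (?p - (-2)))"
      using r s by simp
    have "cnj (cis (2 * \<theta>)) * (?q - (-2)) = 2 * (cis (2 * \<theta>) * cnj (cis (2 * \<theta>)))"
      unfolding q by simp
    then show "2 \<le> Re (cnj (cis (2 * \<theta>)) * (?q - (-2)))"
      by (simp add: cis_cnj cis_mult)
  qed simp
  moreover have "2 \<le> cmod (w - 2)"
  proof (rule half_plane_norm[OF w, of "-1"])
    have "Re (cnj (- 1) * (?p - 2)) = 2 + (6 - r) * (k * sin \<theta>)"
      unfolding p by simp
    then show "2 \<le> Re (cnj (- 1) * (?p - 2))"
      using r s ks by simp
    show "2 \<le> Re (cnj (- 1) * (?q - 2))"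
      unfolding q by simp
  qed simp
  ultimately show "w \<in> pants" by (simp add: in_pants_iff)
qed

text \<open>
  The right half of the homotopy is the image of the left half under the point reflection at \<open>0\<close>.
\<close>

lemma homotopic_outer_inner:
  assumes k: "k \<in> {1, -1}" and r: "1 \<le> r" "r \<le> 2"
  shows "homotopic_loops pants (circle_loop 0 (of_real (k * (6 - r)) * \<i>) k)
    (circle_loop (-2) 2 k +++ circle_loop 2 (-2) k)"
proof (rule homotopic_loops_linear)
  let ?z = "of_real (k * (6 - r)) * \<i>"
  fix t :: real assume t: "t \<in> {0..1}"
  show "closed_segment (circle_loop 0 ?z k t) ((circle_loop (-2) 2 k +++ circle_loop 2 (-2) k) t) \<subseteq> pants"
  proof (cases "t \<le> 1/2")
    case True
    then show ?thesis using segment_outer_inner[OF k r, of t] t by (simp add: joinpaths_def)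
  next
    case False
    define t' where "t' = t - 1/2"
    have half_turn: "cis (pi * k) = - 1" using k by (auto simp: complex_eq_iff)
    have "2 * pi * k * t = 2 * pi * k * t' + pi * k" by (simp add: t'_def algebra_simps)
    then have "cis (2 * pi * k * t) = - cis (2 * pi * k * t')"
      using half_turn by (simp only: cis_mult[symmetric]) simp
    then have 1: "circle_loop 0 ?z k t = - circle_loop 0 ?z k t'"
      by (simp add: circle_loop_def)
    have 2: "(circle_loop (-2) 2 k +++ circle_loop 2 (-2) k) t = - circle_loop (-2) 2 k (2 * t')"
    proof -
      have "2 * t - 1 = 2 * t'" by (simp add: t'_def)
      then show ?thesis using False by (simp add: joinpaths_def circle_loop_def)
    qed
    have segment: "closed_segment (- circle_loop 0 ?z k t') (- circle_loop (-2) 2 k (2 * t'))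
        = uminus ` closed_segment (circle_loop 0 ?z k t') (circle_loop (-2) 2 k (2 * t'))"
      by (rule closed_segment_linear_image) (rule linear_uminus)
    have "- w \<in> pants" if "w \<in> pants" for w
    proof -
      have "cmod (- w + 2) = cmod (w - 2)" "cmod (- w - 2) = cmod (w + 2)"
        using norm_minus_commute[of 2 w] norm_minus_cancel[of "w + 2"] by simp_all
      then show ?thesis using that by (simp only: in_pants_iff norm_minus_cancel)
    qed
    moreover have "closed_segment (circle_loop 0 ?z k t') (circle_loop (-2) 2 k (2 * t')) \<subseteq> pants"
      using t False by (intro segment_outer_inner[OF k r]) (auto simp: t'_def)
    ultimately show ?thesis unfolding 1 2 segment by blast
  qed
qed (use k in simp_all)

lemma represents_rim:
  assumes g: "g \<in> peripheral" and r: "1 \<le> r" "r \<le> 2"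
  shows "represents (gen_word g) (rim g r)"
proof -
  have 1: "represents [a] (circle_loop c (e * of_real r) k)"
    if "letter_loop a = circle_loop c z k" "z = e * 2" "c \<in> {-2, 2}" "k \<in> {1, -1}" "e \<in> {1, -1}" for a c e k z
    using represents_letter[of "circle_loop c (e * of_real r) k" a] homotopic_concentric[OF r that(3-5)]
      that(1,2) by simp
  have 2: "represents [a, b] (circle_loop 0 (of_real (k * (6 - r)) * \<i>) k)"
    if "letter_loop a = circle_loop (-2) 2 k" "letter_loop b = circle_loop 2 (-2) k" "k \<in> {1, -1}" for a b k
    using represents_two_letters[of _ a b] homotopic_outer_inner[OF that(3) r] that(1,2) by simp
  note letters = 1[OF letter_loop_circle_loop(1), of 1] 1[OF letter_loop_circle_loop(2), of 1]
    1[OF letter_loop_circle_loop(3), of "-1"] 1[OF letter_loop_circle_loop(4), of "-1"]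
    2[OF letter_loop_circle_loop(1,3)] 2[OF letter_loop_circle_loop(2,4)]
  show ?thesis
    using g unfolding peripheral_def
    by (elim insertE emptyE) (use letters in simp_all)
qed

lemma path_image_rim:
  assumes "g \<in> peripheral" "1 \<le> r" "r \<le> 2" "w \<in> path_image (rim g r)"
  shows "cmod (w + 2) = r \<or> cmod (w - 2) = r \<or> cmod w = 6 - r"
proof -
  have "path_image (circle_loop (-2) (of_real r) k) \<subseteq> sphere (-2) r"
    "path_image (circle_loop 2 (- of_real r) k) \<subseteq> sphere 2 r"
    "path_image (circle_loop 0 (of_real (6 - r) * \<i>) k) \<subseteq> sphere 0 (6 - r)"
    "path_image (circle_loop 0 (- of_real (6 - r) * \<i>) k) \<subseteq> sphere 0 (6 - r)" for k
    using path_image_circle_loop[of "-2" "of_real r" k] path_image_circle_loop[of 2 "- of_real r" k]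
      path_image_circle_loop[of 0 "of_real (6 - r) * \<i>" k]
      path_image_circle_loop[of 0 "- of_real (6 - r) * \<i>" k]
      assms(2,3) by (simp_all add: norm_mult del: of_real_diff)
  then have "path_image (rim g r) \<subseteq> sphere (-2) r \<union> sphere 2 r \<union> sphere 0 (6 - r)"
    using assms(1) unfolding peripheral_def by (elim insertE emptyE; simp only: rim.simps; blast)
  then have "w \<in> sphere (-2) r \<union> sphere 2 r \<union> sphere 0 (6 - r)"
    using assms(4) by (rule subsetD)
  then show ?thesis unfolding Un_iff in_sphere_iff by blast
qed

lemma goldman_formula_disjoint:
  assumes B: "goldman_formula s B" and "immersed_loop \<alpha>" "immersed_loop \<beta>"
    and disj: "path_image \<alpha> \<inter> path_image \<beta> = {}" and uv: "represents u \<alpha>" "represents v \<beta>"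
  shows "B (tr_word u) (tr_word v) = 0"
proof -
  have empty: "intersections \<alpha> \<beta> = {}" using disj by (simp add: intersections_def)
  then have "generic_position \<alpha> \<beta>" using assms by (simp add: generic_position_def)
  then have "B (tr_word u) (tr_word v) = (\<lambda>\<rho>. \<Sum>p\<in>intersections \<alpha> \<beta>.
      of_real (intersection_number s p \<alpha> \<beta>) * (tr_word [] \<rho> - 1/3 * tr_word u \<rho> * tr_word v \<rho>))"
    using uv empty by (intro B[unfolded goldman_formula_def, rule_format, where w = "\<lambda>_. []"]) simp
  then show ?thesis by (simp add: empty zero_fun_def)
qed

text \<open>
  The boundary curve is taken on the boundary itself, with \<open>r = 1\<close>. The other curve is either again
  parallel to the boundary, with \<open>r = 3/2\<close>, or a figure eight of two circles of radius 2.
\<close>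

lemma goldman_peripheral:
  assumes B: "goldman_formula s B" and g: "g \<in> peripheral" and h: "h \<noteq> T5"
  shows "B (t_gen g) (t_gen h) = 0"
proof -
  have disjoint: "B (t_gen g) (t_gen h) = 0"
    if "immersed_loop \<beta>" "represents (gen_word h) \<beta>"
      "\<And>w. w \<in> path_image \<beta> \<Longrightarrow> w \<notin> path_image (rim g 1)" for \<beta>
    unfolding t_gen_def using that
    by (intro goldman_formula_disjoint[OF B immersed_rim[OF g, of 1] that(1) _ represents_rim[OF g]]) auto
  show ?thesis
  proof (cases "h \<in> peripheral")
    case True
    have "w \<notin> path_image (rim g 1)" if "w \<in> path_image (rim h (3/2))" for w
      using path_image_rim[OF g, of 1 w] path_image_rim[OF True _ _ that] triangle_centres[of w] by auto
    then show ?thesis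
      by (intro disjoint[of "rim h (3/2)"] immersed_rim represents_rim True) simp_all
  next
    case False
    have *: "w \<notin> path_image (rim g 1)" if "w \<in> path_image (letter_loop a +++ letter_loop b)" for w a b
    proof -
      have "w \<in> sphere (-2) 2 \<union> sphere 2 2"
        using path_image_join_subset[of "letter_loop a" "letter_loop b"] that
          path_image_letter_loop[of a] path_image_letter_loop[of b] by blast
      then have "cmod (w + 2) = 2 \<or> cmod (w - 2) = 2"
        unfolding Un_iff in_sphere_iff .
      then show ?thesis
        using path_image_rim[OF g, of 1 w] triangle_centres[of w] by auto
    qed
    have rep: "represents [a, b] (letter_loop a +++ letter_loop b)" for a b
      using path_image_join_subset[of "letter_loop a" "letter_loop b"]
        letter_loop_simps(4)[of a] letter_loop_simps(4)[of b]
      by (intro represents_two_letters) (auto simp: letter_loop_simps(1-3) homotopic_loops_refl)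
    have "immersed_loop (letter_loop X1 +++ letter_loop X2')"
      "immersed_loop (letter_loop X1' +++ letter_loop X2)"
      unfolding letter_loop_circle_loop
      using immersed_figure_eight[of 1] immersed_figure_eight[of "-1"] by simp_all
    moreover have "h = T4 \<or> h = T4'"
      using False h by (cases h) (simp_all add: peripheral_def)
    moreover have "B (t_gen g) (t_gen h) = 0"
      if "gen_word h = [a, b]" "immersed_loop (letter_loop a +++ letter_loop b)" for a b
      by (rule disjoint[OF that(2)]) (simp_all only: that(1) rep * not_False_eq_True)
    ultimately show ?thesis by (elim disjE) (simp_all only: gen_word.simps)
  qed
qed

section \<open>Regular functions on pairs of matrices\<close>

lemma regular_uminus: "f \<in> regular_functions \<Longrightarrow> - f \<in> regular_functions"
  using regular_functions.mult[OF regular_functions.const[of "-1"], of f]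
  by (simp add: times_fun_def fun_Compl_def)

lemma regular_diff:
  assumes "f \<in> regular_functions" "g \<in> regular_functions"
  shows "f - g \<in> regular_functions"
  using regular_functions.add[OF assms(1) regular_uminus[OF assms(2)]] by simp

lemma regular_pointwise:
  assumes "f \<in> regular_functions" "g \<in> regular_functions"
  shows "(\<lambda>\<rho>. f \<rho> + g \<rho>) \<in> regular_functions" "(\<lambda>\<rho>. f \<rho> - g \<rho>) \<in> regular_functions"
    "(\<lambda>\<rho>. f \<rho> * g \<rho>) \<in> regular_functions"
  using regular_functions.add[OF assms] regular_functions.mult[OF assms] regular_diff[OF assms]
  by (simp_all add: plus_fun_def times_fun_def fun_diff_def)

text \<open>
  In terms of cofactors, the entries of the inverse of a unimodular matrix are polynomials in the
  entries of the matrix.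
\<close>

definition adjugate3 :: "complex^3^3 \<Rightarrow> complex^3^3" where
  "adjugate3 A = vector
     [vector [A$2$2 * A$3$3 - A$2$3 * A$3$2, A$1$3 * A$3$2 - A$1$2 * A$3$3, A$1$2 * A$2$3 - A$1$3 * A$2$2],
      vector [A$2$3 * A$3$1 - A$2$1 * A$3$3, A$1$1 * A$3$3 - A$1$3 * A$3$1, A$1$3 * A$2$1 - A$1$1 * A$2$3],
      vector [A$2$1 * A$3$2 - A$2$2 * A$3$1, A$1$2 * A$3$1 - A$1$1 * A$3$2, A$1$1 * A$2$2 - A$1$2 * A$2$1]]"

lemma mult_adjugate3: "A ** adjugate3 A = mat (det A)"
  by (simp add: vec_eq_iff forall_3 matrix_matrix_mult_def sum_3 adjugate3_def vector_3 mat_def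
      det_3 algebra_simps)

lemma Rep_inverse: "Rep_sl3 (inverse A) = adjugate3 (Rep_sl3 A)"
proof -
  have "det (Rep_sl3 A) = 1" using Rep_sl3[of A] by simp
  then have "matrix_inv (Rep_sl3 A) ** Rep_sl3 A = mat 1" "Rep_sl3 A ** adjugate3 (Rep_sl3 A) = mat 1"
    by (simp_all add: matrix_inv_SL mult_adjugate3)
  then show ?thesis
    unfolding inverse_sl3.rep_eq by (metis matrix_mul_assoc matrix_mul_lid matrix_mul_rid)
qed

lemma regular_word_entry: "(\<lambda>\<rho>. Rep_sl3 (eval_word \<rho> w) $ i $ j) \<in> regular_functions"
proof (induction w arbitrary: i j)
  case Nil
  show ?case by (simp add: one_sl3.rep_eq regular_functions.const)
next
  case (Cons a w)
  have "(\<lambda>\<rho>. Rep_sl3 (eval_letter \<rho> a) $ k $ l) \<in> regular_functions" for k l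
  proof -
    have "eval_letter \<rho> X1 = fst \<rho>" "eval_letter \<rho> X1' = inverse (fst \<rho>)"
      "eval_letter \<rho> X2 = snd \<rho>" "eval_letter \<rho> X2' = inverse (snd \<rho>)" for \<rho>
      by (cases \<rho>; simp)+
    then show ?thesis
      using exhaust_3[of k] exhaust_3[of l]
      by (cases a) (auto simp: Rep_inverse adjugate3_def vector_3
          intro!: regular_pointwise regular_functions.entry1 regular_functions.entry2)
  qed
  then show ?case
    using Cons by (simp add: times_sl3.rep_eq matrix_matrix_mult_def sum_3 regular_pointwise)
qed

lemma regular_tr_word: "tr_word w \<in> regular_functions"
  unfolding tr_word_def tr_def trace_def sum_3 by (intro regular_pointwise regular_word_entry)

lemma eval_word_conj:
  "eval_word (C * A * inverse C, C * B * inverse C) w = C * eval_word (A, B) w * inverse C"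
proof (induction w)
  case Nil
  show ?case by simp
next
  case (Cons a w)
  have cancel: "inverse C * (C * D) = D" for D :: sl3
    by (metis mult.assoc mult_1_left sl3_inverse(2))
  have inv: "inverse (C * D * inverse C) = C * inverse D * inverse C" for D :: sl3
    by (rule sl3_inverse_unique) (metis (no_types, opaque_lifting) cancel mult.assoc mult_1_left sl3_inverse(1))
  have "eval_letter (C * A * inverse C, C * B * inverse C) a = C * eval_letter (A, B) a * inverse C"
    by (cases a) (simp_all add: inv)
  then show ?case using Cons by (simp add: mult.assoc cancel)
qed

lemma tr_word_in_coordinate_ring [intro, simp]: "tr_word w \<in> coordinate_ring"
proof -
  have "tr (C * D * inverse C) = tr D" for C D
    using tr_commute[of "C * D" "inverse C"] by (metis mult.assoc mult_1_left sl3_inverse(2))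
  then show ?thesis
    using regular_tr_word[of w] by (simp add: coordinate_ring_def tr_word_def eval_word_conj)
qed

lemma coordinate_ring_closed:
  "(\<lambda>\<rho>. c) \<in> coordinate_ring"
  "f \<in> coordinate_ring \<Longrightarrow> g \<in> coordinate_ring \<Longrightarrow> f + g \<in> coordinate_ring"
  "f \<in> coordinate_ring \<Longrightarrow> g \<in> coordinate_ring \<Longrightarrow> f * g \<in> coordinate_ring"
  by (auto simp: coordinate_ring_def regular_functions.intros)

definition matrix_line :: "complex^3^3 \<Rightarrow> complex^3^3 \<Rightarrow> complex \<Rightarrow> complex^3^3" where
  "matrix_line M N z = (\<chi> i j. M$i$j + z * (N$i$j - M$i$j))"

text \<open>
  Dividing one row by the determinant brings the line through two unimodular matrices back into
  the group, at the price of rational instead of polynomial entries. Where the determinant of the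
  line vanishes, the value is arbitrary.
\<close>

definition unimodular_path :: "sl3 \<Rightarrow> sl3 \<Rightarrow> complex \<Rightarrow> sl3" where
  "unimodular_path A B z = (let L = matrix_line (Rep_sl3 A) (Rep_sl3 B) z in
     Abs_sl3 (\<chi> i j. if i = 1 then L$i$j / det L else L$i$j))"

lemma Rep_unimodular_path:
  fixes A B z
  defines "L \<equiv> matrix_line (Rep_sl3 A) (Rep_sl3 B) z"
  assumes "det L \<noteq> 0"
  shows "Rep_sl3 (unimodular_path A B z) = (\<chi> i j. if i = 1 then L$i$j / det L else L$i$j)"
proof -
  have "det (\<chi> i j. if i = 1 then L$i$j / det L else L$i$j) = det L / det L"
    by (subst (1 3) det_3) (simp add: diff_divide_distrib add_divide_distrib)
  then show ?thesis
    using assms(2) unfolding unimodular_path_def Let_def L_def[symmetric] by (simp add: Abs_sl3_inverse)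
qed

lemma det_Rep_sl3 [simp]: "det (Rep_sl3 A) = 1"
  using Rep_sl3[of A] by simp

lemma line_ends [simp]: "matrix_line M N 0 = M" "matrix_line M N 1 = N"
  by (simp_all add: matrix_line_def vec_eq_iff)

lemma unimodular_path_ends [simp]: "unimodular_path A B 0 = A" "unimodular_path A B 1 = B"
  by (simp_all add: Rep_sl3_inject[symmetric] Rep_unimodular_path vec_eq_iff)

lemma entry_line_poly: "\<exists>p. \<forall>z. matrix_line M N z $ i $ j = poly p z"
  by (rule exI[of _ "[:M$i$j, N$i$j - M$i$j:]"]) (simp add: matrix_line_def)

lemma det_line_poly: "\<exists>p. \<forall>z. det (matrix_line M N z) = poly p z"
proof -
  obtain q where "matrix_line M N z $ i $ j = poly (q i j) z" for i j z
    using entry_line_poly by metis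
  then show ?thesis
    unfolding det_3 by (simp flip: poly_mult poly_add poly_diff) blast
qed

text \<open>
  Any two points of the group are joined by a rational curve \<open>\<gamma>\<close>, along which regular functions become
  polynomials in one variable after multiplication by a power of the common denominator \<open>d\<close>. If a
  product vanishes, so does the product of these polynomials; as \<open>h\<close> does not vanish at the start of
  the curve, \<open>f\<close> vanishes at its end.
\<close>

lemma regular_zero_divisor:
  fixes \<sigma> :: rep
  assumes f: "f \<in> regular_functions" and h: "h \<in> regular_functions"
    and fh: "f * h = 0" and nz: "h \<sigma> \<noteq> 0"
  shows "f = 0"
proof
  fix \<rho> :: rep
  obtain A0 B0 A B where \<rho>: "\<sigma> = (A0, B0)" "\<rho> = (A, B)" by (metis surj_pair)
  let ?L = "matrix_line (Rep_sl3 A0) (Rep_sl3 A)" and ?M = "matrix_line (Rep_sl3 B0) (Rep_sl3 B)"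
  define \<gamma> where "\<gamma> z = (unimodular_path A0 A z, unimodular_path B0 B z)" for z
  obtain p q where p: "\<And>z. det (?L z) = poly p z" and q: "\<And>z. det (?M z) = poly q z"
    using det_line_poly by metis
  define d where "d = p * q"
  have "poly p 0 = 1" "poly p 1 = 1" "poly q 0 = 1" "poly q 1 = 1"
    by (simp_all flip: p q)
  then have d01: "poly d 0 = 1" "poly d 1 = 1" by (simp_all add: d_def)
  have ends: "\<gamma> 0 = \<sigma>" "\<gamma> 1 = \<rho>" by (simp_all add: \<gamma>_def \<rho>)
  have rational: "\<exists>r n. \<forall>z. poly d z \<noteq> 0 \<longrightarrow> k (\<gamma> z) * poly d z ^ n = poly r z"
    if "k \<in> regular_functions" for k
    using that
  proof (induction k rule: regular_functions.induct)
    case (const c)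
    show ?case by (rule exI[of _ "[:c:]"], rule exI[of _ 0]) simp
  next
    case (entry1 i j)
    obtain e where e: "\<And>z. ?L z $ i $ j = poly e z" using entry_line_poly by metis
    have "Rep_sl3 (fst (\<gamma> z)) $ i $ j * poly d z ^ 1 = poly (e * (if i = 1 then q else d)) z"
      if "poly d z \<noteq> 0" for z
      using that e[of z] by (auto simp: \<gamma>_def d_def Rep_unimodular_path p)
    then show ?case by blast
  next
    case (entry2 i j)
    obtain e where e: "\<And>z. ?M z $ i $ j = poly e z" using entry_line_poly by metis
    have "Rep_sl3 (snd (\<gamma> z)) $ i $ j * poly d z ^ 1 = poly (e * (if i = 1 then p else d)) z"
      if "poly d z \<noteq> 0" for z
      using that e[of z] by (auto simp: \<gamma>_def d_def Rep_unimodular_path q)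
    then show ?case by blast
  next
    case (add f g)
    then obtain r n r' n' where
      1: "\<And>z. poly d z \<noteq> 0 \<Longrightarrow> f (\<gamma> z) * poly d z ^ n = poly r z"
      and 2: "\<And>z. poly d z \<noteq> 0 \<Longrightarrow> g (\<gamma> z) * poly d z ^ n' = poly r' z" by metis
    have "(f + g) (\<gamma> z) * poly d z ^ (n + n') = poly (r * d ^ n' + r' * d ^ n) z"
      if "poly d z \<noteq> 0" for z
      by (simp add: algebra_simps power_add flip: 1[OF that] 2[OF that])
    then show ?case by blast
  next
    case (mult f g)
    then obtain r n r' n' where
      1: "\<And>z. poly d z \<noteq> 0 \<Longrightarrow> f (\<gamma> z) * poly d z ^ n = poly r z"
      and 2: "\<And>z. poly d z \<noteq> 0 \<Longrightarrow> g (\<gamma> z) * poly d z ^ n' = poly r' z" by metis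
    have "(f * g) (\<gamma> z) * poly d z ^ (n + n') = poly (r * r') z"
      if "poly d z \<noteq> 0" for z
      by (simp add: algebra_simps power_add flip: 1[OF that] 2[OF that])
    then show ?case by blast
  qed
  obtain r n where r: "\<And>z. poly d z \<noteq> 0 \<Longrightarrow> f (\<gamma> z) * poly d z ^ n = poly r z"
    using rational[OF f] by metis
  obtain r' n' where r': "\<And>z. poly d z \<noteq> 0 \<Longrightarrow> h (\<gamma> z) * poly d z ^ n' = poly r' z"
    using rational[OF h] by metis
  have "poly (r * r' * d) z = 0" for z
  proof (cases "poly d z = 0")
    case False
    have "f (\<gamma> z) * h (\<gamma> z) = 0" using fun_cong[OF fh] by simp
    then show ?thesis by (auto simp flip: r[OF False] r'[OF False])
  qed simp
  then have "r * r' * d = 0" using poly_all_0_iff_0 by blast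
  moreover have "d \<noteq> 0" "r' \<noteq> 0" using d01 r'[of 0] nz by (auto simp: ends)
  ultimately have "r = 0" by simp
  then show "f \<rho> = 0 \<rho>" using r[of 1] d01 by (simp add: ends)
qed

section \<open>Diagonalisation of generic matrices\<close>

lemma tr_eq: "tr A = Rep_sl3 A $ 1 $ 1 + Rep_sl3 A $ 2 $ 2 + Rep_sl3 A $ 3 $ 3"
  by (simp add: tr_def trace_def sum_3)

lemma tr_inverse_eq: "tr (inverse A) =
    (Rep_sl3 A $ 2 $ 2 * Rep_sl3 A $ 3 $ 3 - Rep_sl3 A $ 2 $ 3 * Rep_sl3 A $ 3 $ 2)
  + (Rep_sl3 A $ 1 $ 1 * Rep_sl3 A $ 3 $ 3 - Rep_sl3 A $ 1 $ 3 * Rep_sl3 A $ 3 $ 1)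
  + (Rep_sl3 A $ 1 $ 1 * Rep_sl3 A $ 2 $ 2 - Rep_sl3 A $ 1 $ 2 * Rep_sl3 A $ 2 $ 1)"
  by (simp add: tr_eq Rep_inverse adjugate3_def vector_3)

text \<open>
  For a unimodular \<open>A\<close>, the characteristic polynomial is \<open>z\<^sup>3 - tr A z\<^sup>2 + tr A\<^sup>-\<^sup>1 z - 1\<close>.
\<close>

lemma eigenvector_exists:
  assumes a: "a^3 - tr A * a^2 + tr (inverse A) * a - 1 = 0"
  obtains v where "v \<noteq> 0" "Rep_sl3 A *v v = a *s v"
proof -
  let ?A = "Rep_sl3 A"
  let ?E = "\<chi> i j. ?A$i$j - (if i = j then a else 0)"
  have "det ?A = 1" by simp
  then have "det ?E = 0"
    using a[unfolded tr_inverse_eq, unfolded tr_eq] unfolding det_3 by simp algebra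
  then have "\<not> invertible ?E" by (simp add: invertible_det_nz)
  then have "\<not> (\<exists>F. F ** ?E = mat 1)" by (simp add: invertible_left_inverse)
  then obtain v where "v \<noteq> 0" "?E *v v = 0" unfolding matrix_left_invertible_ker by blast
  moreover have "?E *v v = ?A *v v - a *s v"
    by (simp add: vec_eq_iff forall_3 matrix_vector_mult_def sum_3 algebra_simps)
  ultimately show ?thesis using that[of v] by simp
qed

lemma cubic_splits:
  fixes p q :: complex
  obtains a b c where "a + b + c = p" "a * b + b * c + c * a = q" "a * b * c = 1"
proof -
  have "\<not> constant (poly [:-1, q, -p, 1:])"
    by (simp add: constant_degree)
  then obtain a where "poly [:-1, q, -p, 1:] a = 0"
    using fundamental_theorem_of_algebra by blast
  then have a: "a^3 - p * a^2 + q * a - 1 = 0"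
    by (simp add: algebra_simps power2_eq_square power3_eq_cube)
  define \<delta> where "\<delta> = csqrt ((p - a)^2 - 4 * (a^2 - p * a + q))"
  have d: "\<delta>^2 = (p - a)^2 - 4 * (a^2 - p * a + q)" by (simp add: \<delta>_def)
  define b c where "b = (p - a + \<delta>) / 2" and "c = (p - a - \<delta>) / 2"
  have bc: "b + c = p - a" by (simp add: b_def c_def field_simps)
  have "2 * b = p - a + \<delta>" "2 * c = p - a - \<delta>" by (simp_all add: b_def c_def)
  then have "4 * (b * c) = 4 * (a^2 - p * a + q)" using d by algebra
  then have bc': "b * c = a^2 - p * a + q" unfolding mult_cancel_left by simp
  show ?thesis
  proof (rule that[of a b c])
    show "a + b + c = p" using bc by (simp add: add.assoc)
    show "a * b + b * c + c * a = q" using bc bc' by algebra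
    show "a * b * c = 1" using a bc' by algebra
  qed
qed

text \<open>
  The discriminant of the characteristic polynomial, written as a polynomial in traces.
\<close>

definition char_disc :: "sl3 \<Rightarrow> complex" where
  "char_disc A = (tr A)^2 * (tr (inverse A))^2 - 4 * (tr A)^3 - 4 * (tr (inverse A))^3
     + 18 * tr A * tr (inverse A) - 27"

text \<open>
  The eigenvalues are distinct, so eigenvectors for them form a basis; rescaling one of them gives
  a base change of determinant 1.
\<close>

lemma diagonalisable_if_char_disc_nonzero:
  assumes "char_disc A \<noteq> 0"
  obtains C where "\<And>i j. i \<noteq> j \<Longrightarrow> Rep_sl3 (C * A * inverse C) $ i $ j = 0"
proof -
  obtain a b c where abc: "a + b + c = tr A" "a * b + b * c + c * a = tr (inverse A)" "a * b * c = 1"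
    by (rule cubic_splits)
  have "(a + b + c)^2 * (a * b + b * c + c * a)^2 - 4 * (a + b + c)^3 * (a * b * c)
      - 4 * (a * b + b * c + c * a)^3 + 18 * (a + b + c) * (a * b + b * c + c * a) * (a * b * c)
      - 27 * (a * b * c)^2 = (a - b)^2 * (b - c)^2 * (c - a)^2"
    by algebra
  then have "char_disc A = (a - b)^2 * (b - c)^2 * (c - a)^2"
    unfolding abc char_disc_def by simp
  then have distinct: "a \<noteq> b" "b \<noteq> c" "c \<noteq> a" using assms by auto
  have "x^3 - (a + b + c) * x^2 + (a * b + b * c + c * a) * x - a * b * c = (x - a) * (x - b) * (x - c)" for x
    by algebra
  then have "x^3 - tr A * x^2 + tr (inverse A) * x - 1 = (x - a) * (x - b) * (x - c)" for x
    unfolding abc .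
  then obtain u v w where u: "u \<noteq> 0" "Rep_sl3 A *v u = a *s u" and v: "v \<noteq> 0" "Rep_sl3 A *v v = b *s v"
    and w: "w \<noteq> 0" "Rep_sl3 A *v w = c *s w"
    using eigenvector_exists[of a A] eigenvector_exists[of b A] eigenvector_exists[of c A]
    by (metis cancel_comm_monoid_add_class.diff_cancel mult_zero_left mult_zero_right)
  define S :: "complex^3^3" where "S = (\<chi> i j. if j = 1 then u$i else if j = 2 then v$i else w$i)"
  define D :: "complex^3^3"
    where "D = (\<chi> i j. if i = j then (if j = 1 then a else if j = 2 then b else c) else 0)"
  have entries: "Rep_sl3 A$i$1 * u$1 + Rep_sl3 A$i$2 * u$2 + Rep_sl3 A$i$3 * u$3 = a * u$i"
    "Rep_sl3 A$i$1 * v$1 + Rep_sl3 A$i$2 * v$2 + Rep_sl3 A$i$3 * v$3 = b * v$i"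
    "Rep_sl3 A$i$1 * w$1 + Rep_sl3 A$i$2 * w$2 + Rep_sl3 A$i$3 * w$3 = c * w$i" for i
    using u(2) v(2) w(2) by (simp_all add: vec_eq_iff matrix_vector_mult_def sum_3)
  have AS: "Rep_sl3 A ** S = S ** D"
    by (simp add: vec_eq_iff forall_3 matrix_matrix_mult_def sum_3 S_def D_def entries)
  \<comment> \<open>Applying \<open>A\<close> twice to a linear relation between the eigenvectors gives a Vandermonde system.\<close>
  have "x = 0" if x: "S *v x = 0" for x
  proof -
    have comb: "(x$1) *s u + (x$2) *s v + (x$3) *s w = 0"
      using x by (simp add: vec_eq_iff matrix_vector_mult_def sum_3 S_def mult.commute)
    have A1: "(a * x$1) *s u + (b * x$2) *s v + (c * x$3) *s w = 0"
      if "(x$1) *s u + (x$2) *s v + (x$3) *s w = 0" for x :: "complex^3"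
    proof -
      have "Rep_sl3 A *v ((x$1) *s u + (x$2) *s v + (x$3) *s w) = 0" by (simp add: that)
      then show ?thesis
        by (simp add: matrix_vector_right_distrib vector_scalar_commute u v w vector_smult_assoc mult.commute)
    qed
    have "(a * x$1) *s u + (b * x$2) *s v + (c * x$3) *s w = 0"
      using A1[OF comb] .
    moreover have "(a * (a * x$1)) *s u + (b * (b * x$2)) *s v + (c * (c * x$3)) *s w = 0"
      using A1[of "\<chi> i. if i = 1 then a * x$1 else if i = 2 then b * x$2 else c * x$3"] A1[OF comb] by simp
    ultimately have l: "x$1 * u$i + x$2 * v$i + x$3 * w$i = 0"
      "a * x$1 * u$i + b * x$2 * v$i + c * x$3 * w$i = 0"
      "a * (a * x$1) * u$i + b * (b * x$2) * v$i + c * (c * x$3) * w$i = 0" for i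
      using comb by (simp_all add: vec_eq_iff)
    have "(a - b) * (a - c) * x$1 * u$i = 0" "(b - a) * (b - c) * x$2 * v$i = 0"
      "(c - a) * (c - b) * x$3 * w$i = 0" for i
      using l[of i] by algebra+
    then have "x$1 = 0" "x$2 = 0" "x$3 = 0"
      using distinct u(1) v(1) w(1) by (auto simp: vec_eq_iff)
    then show ?thesis by (simp add: vec_eq_iff forall_3)
  qed
  then have "\<exists>F. F ** S = mat 1" unfolding matrix_left_invertible_ker by blast
  then have "det S \<noteq> 0" by (simp flip: invertible_left_inverse invertible_det_nz)
  define T :: "complex^3^3" where "T = (\<chi> i j. if j = 1 then S$i$j / det S else S$i$j)"
  have "det T = det S / det S"
    unfolding T_def by (subst (1 2) det_3) (simp add: diff_divide_distrib add_divide_distrib)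
  then have "det T = 1" using \<open>det S \<noteq> 0\<close> by simp
  have AT: "Rep_sl3 A ** T = T ** D"
  proof -
    have "(Rep_sl3 A ** T)$i$j = (T ** D)$i$j" for i j
    proof -
      have "(Rep_sl3 A ** S)$i$j = (S ** D)$i$j" by (simp add: AS)
      then show ?thesis
        using exhaust_3[of j]
        by (auto simp: matrix_matrix_mult_def sum_3 T_def D_def simp flip: add_divide_distrib)
    qed
    then show ?thesis by (simp add: vec_eq_iff)
  qed
  define C where "C = inverse (Abs_sl3 T)"
  have T: "Rep_sl3 (Abs_sl3 T) = T" using \<open>det T = 1\<close> by (simp add: Abs_sl3_inverse)
  have C_inv: "inverse C = Abs_sl3 T" unfolding C_def by (rule sl3_inverse_unique) simp
  have "Rep_sl3 (C * A * inverse C) = Rep_sl3 C ** (Rep_sl3 A ** T)"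
    by (simp add: C_inv times_sl3.rep_eq T matrix_mul_assoc)
  also have "\<dots> = Rep_sl3 (C * inverse C) ** D"
    by (simp add: AT C_inv times_sl3.rep_eq T matrix_mul_assoc del: sl3_inverse)
  also have "\<dots> = D" by (simp add: one_sl3.rep_eq)
  finally show ?thesis using that[of C] by (simp add: D_def)
qed

section \<open>Traces of the commutator and its inverse\<close>

text \<open>
  Let \<open>A\<close> be diagonal with entries \<open>a\<^sub>i\<close>, and let \<open>b\<^sub>i\<close>, \<open>c\<^sub>i\<close> be the diagonal entries of \<open>B\<close> and \<open>B\<^sup>-\<^sup>1\<close>. Then
  \<open>t\<^bsub>(\<plusminus>2)\<^esub>\<close>, \<open>t\<^bsub>(\<plusminus>3)\<^esub>\<close>, \<open>t\<^bsub>(\<plusminus>4)\<^esub>\<close> are linear in the \<open>b\<^sub>i\<close> and \<open>c\<^sub>i\<close>. The trace of the commutator involves the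
  off-diagonal entries of \<open>B\<close> through the products of opposite ones, which are
  \<open>b\<^sub>j b\<^sub>k - c\<^sub>i\<close>, and through the products \<open>u\<close>, \<open>v\<close> along the two 3-cycles; it has the form
  \<open>e + \<alpha> u + \<beta> v\<close>, and inverting the commutator exchanges \<open>u\<close> and \<open>v\<close>. Now \<open>u + v\<close> is determined by
  \<open>det B = 1\<close>, and \<open>u v\<close> is the product of the three products of opposite entries. Hence the sum of the
  two traces is \<open>2 e + (\<alpha> + \<beta>) (u + v)\<close>, and four times their product is the square of the sum minus
  \<open>(\<alpha> - \<beta>)\<^sup>2 (u - v)\<^sup>2\<close>, all of which are polynomials in the \<open>a\<^sub>i\<close>, \<open>b\<^sub>i\<close>, \<open>c\<^sub>i\<close>.
\<close>

lemma diagonal_trace_identities: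
  fixes x :: "gen \<Rightarrow> complex" and a1 a2 a3 b1 b2 b3 c1 c2 c3 u v :: complex
  defines "a1' \<equiv> a2 * a3" and "a2' \<equiv> a3 * a1" and "a3' \<equiv> a1 * a2"
  defines "al \<equiv> a1 * a2' + a2 * a3' + a3 * a1'" and "be \<equiv> a2 * a1' + a3 * a2' + a1 * a3'"
  assumes a: "a1 * a2 * a3 = 1"
    and x: "x T1 = a1 + a2 + a3" "x T1' = a1' + a2' + a3'" "x T2 = b1 + b2 + b3" "x T2' = c1 + c2 + c3"
      "x T3 = a1 * b1 + a2 * b2 + a3 * b3" "x T3' = a1' * c1 + a2' * c2 + a3' * c3"
      "x T4 = a1 * c1 + a2 * c2 + a3 * c3" "x T4' = a1' * b1 + a2' * b2 + a3' * b3"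
    and uv: "u + v = 1 + 2 * (b1 * b2 * b3) - (b1 * c1 + b2 * c2 + b3 * c3)"
      "u * v = (b2 * b3 - c1) * (b3 * b1 - c2) * (b1 * b2 - c3)"
  defines "e \<equiv> (1 + a2 * a3' + a3 * a2') * (b1 * c1) + (1 + a3 * a1' + a1 * a3') * (b2 * c2)
     + (1 + a1 * a2' + a2 * a1') * (b3 * c3) - (al + be) * (b1 * b2 * b3)"
  shows "insertion x P_poly = (e + al * u + be * v) + (e + be * u + al * v)"
    and "insertion x Q_poly = (e + al * u + be * v) * (e + be * u + al * v)"
proof -
  have "insertion x P_poly = 2 * e + (al + be) * (1 + 2 * (b1 * b2 * b3) - (b1 * c1 + b2 * c2 + b3 * c3))"
    unfolding e_def al_def be_def a1'_def a2'_def a3'_def P_poly_def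
    using a by (simp add: x a1'_def a2'_def a3'_def) algebra
  then have P: "insertion x P_poly = 2 * e + (al + be) * (u + v)"
    by (simp add: uv)
  then show "insertion x P_poly = (e + al * u + be * v) + (e + be * u + al * v)"
    by (simp add: algebra_simps)
  have "(u - v)^2 = (u + v)^2 - 4 * (u * v)" by algebra
  also have "\<dots> = 1 - 2 * (b1 * c1 + b2 * c2 + b3 * c3) + (b1 * c1 + b2 * c2 + b3 * c3)^2
      - 4 * (b1 * c1 * (b2 * c2) + b2 * c2 * (b3 * c3) + b3 * c3 * (b1 * c1))
      + 4 * (b1 * b2 * b3) + 4 * (c1 * c2 * c3)"
    unfolding uv by algebra
  finally have D: "(u - v)^2 = \<dots>" .
  have "4 * insertion x Q_poly = (2 * e + (al + be) * (1 + 2 * (b1 * b2 * b3)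
        - (b1 * c1 + b2 * c2 + b3 * c3)))^2
      - (al - be)^2 * (1 - 2 * (b1 * c1 + b2 * c2 + b3 * c3) + (b1 * c1 + b2 * c2 + b3 * c3)^2
      - 4 * (b1 * c1 * (b2 * c2) + b2 * c2 * (b3 * c3) + b3 * c3 * (b1 * c1))
      + 4 * (b1 * b2 * b3) + 4 * (c1 * c2 * c3))"
    unfolding e_def al_def be_def a1'_def a2'_def a3'_def Q_poly_def insertion_add insertion_diff insertion_mult
      insertion_power insertion_numeral insertion_var x
    using a by algebra
  also have "\<dots> = (2 * e + (al + be) * (u + v))^2 - (al - be)^2 * (u - v)^2"
    unfolding D uv ..
  also have "\<dots> = 4 * ((e + al * u + be * v) * (e + be * u + al * v))"
    by algebra
  finally show "insertion x Q_poly = (e + al * u + be * v) * (e + be * u + al * v)"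
    unfolding mult_cancel_left by simp
qed

lemma trace_identities_diagonal:
  assumes diag: "\<And>i j. i \<noteq> j \<Longrightarrow> Rep_sl3 A $ i $ j = 0"
  shows "at_traces P_poly (A, B) = tr_word [X1, X2, X1', X2'] (A, B) + tr_word [X2, X1, X2', X1'] (A, B)"
    and "at_traces Q_poly (A, B) = tr_word [X1, X2, X1', X2'] (A, B) * tr_word [X2, X1, X2', X1'] (A, B)"
proof -
  let ?A = "Rep_sl3 A" and ?B = "Rep_sl3 B" and ?C = "Rep_sl3 (inverse B)"
  define a1 a2 a3 where "a1 = ?A$1$1" and "a2 = ?A$2$2" and "a3 = ?A$3$3"
  note A = a1_def[symmetric] a2_def[symmetric] a3_def[symmetric] diag
  have detA: "a1 * a2 * a3 = 1"
    using det_Rep_sl3[of A] unfolding det_3 by (simp add: A)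
  have "\<forall>i j. i \<noteq> j \<longrightarrow> Rep_sl3 (inverse A) $ i $ j = 0"
    by (simp add: forall_3 Rep_inverse adjugate3_def vector_3 diag)
  then have A': "Rep_sl3 (inverse A) $ 1 $ 1 = a2 * a3" "Rep_sl3 (inverse A) $ 2 $ 2 = a3 * a1"
      "Rep_sl3 (inverse A) $ 3 $ 3 = a1 * a2" "\<And>i j. i \<noteq> j \<Longrightarrow> Rep_sl3 (inverse A) $ i $ j = 0"
    by (simp_all add: Rep_inverse adjugate3_def vector_3 A mult.commute)
  define u v where "u = ?B$1$2 * ?B$2$3 * ?B$3$1" and "v = ?B$1$3 * ?B$3$2 * ?B$2$1"
  have C: "?C$1$1 = ?B$2$2 * ?B$3$3 - ?B$2$3 * ?B$3$2" "?C$2$2 = ?B$1$1 * ?B$3$3 - ?B$1$3 * ?B$3$1"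
    "?C$3$3 = ?B$1$1 * ?B$2$2 - ?B$1$2 * ?B$2$1"
    "?C$1$2 = ?B$1$3 * ?B$3$2 - ?B$1$2 * ?B$3$3" "?C$1$3 = ?B$1$2 * ?B$2$3 - ?B$1$3 * ?B$2$2"
    "?C$2$1 = ?B$2$3 * ?B$3$1 - ?B$2$1 * ?B$3$3" "?C$2$3 = ?B$1$3 * ?B$2$1 - ?B$1$1 * ?B$2$3"
    "?C$3$1 = ?B$2$1 * ?B$3$2 - ?B$2$2 * ?B$3$1" "?C$3$2 = ?B$1$2 * ?B$3$1 - ?B$1$1 * ?B$3$2"
    by (simp_all add: Rep_inverse adjugate3_def vector_3)
  note expand = tr_word_def t_gen_def tr_eq times_sl3.rep_eq matrix_matrix_mult_def sum_3 A A'
  have detB: "?B$1$1 * ?B$2$2 * ?B$3$3 + u + v - ?B$1$1 * ?B$2$3 * ?B$3$2 - ?B$1$2 * ?B$2$1 * ?B$3$3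
     - ?B$1$3 * ?B$2$2 * ?B$3$1 = 1"
    using det_Rep_sl3[of B] unfolding det_3 u_def v_def by (simp add: mult_ac)
  have uv: "u + v = 1 + 2 * (?B$1$1 * ?B$2$2 * ?B$3$3) - (?B$1$1 * ?C$1$1 + ?B$2$2 * ?C$2$2 + ?B$3$3 * ?C$3$3)"
    using detB unfolding C by algebra
  have uv': "u * v = (?B$2$2 * ?B$3$3 - ?C$1$1) * (?B$3$3 * ?B$1$1 - ?C$2$2) * (?B$1$1 * ?B$2$2 - ?C$3$3)"
    unfolding C u_def v_def by algebra
  let ?x = "\<lambda>g. t_gen g (A, B)"
  have x: "?x T1 = a1 + a2 + a3" "?x T1' = a2 * a3 + a3 * a1 + a1 * a2"
    "?x T2 = ?B$1$1 + ?B$2$2 + ?B$3$3" "?x T2' = ?C$1$1 + ?C$2$2 + ?C$3$3"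
    "?x T3 = a1 * ?B$1$1 + a2 * ?B$2$2 + a3 * ?B$3$3"
    "?x T3' = a2 * a3 * ?C$1$1 + a3 * a1 * ?C$2$2 + a1 * a2 * ?C$3$3"
    "?x T4 = a1 * ?C$1$1 + a2 * ?C$2$2 + a3 * ?C$3$3"
    "?x T4' = a2 * a3 * ?B$1$1 + a3 * a1 * ?B$2$2 + a1 * a2 * ?B$3$3"
    by (simp_all add: expand)
  define e where "e = (1 + a2 * (a1 * a2) + a3 * (a3 * a1)) * (?B$1$1 * ?C$1$1)
     + (1 + a3 * (a2 * a3) + a1 * (a1 * a2)) * (?B$2$2 * ?C$2$2)
     + (1 + a1 * (a3 * a1) + a2 * (a2 * a3)) * (?B$3$3 * ?C$3$3)
     - (a1 * (a3 * a1) + a2 * (a1 * a2) + a3 * (a2 * a3) + (a2 * (a2 * a3) + a3 * (a3 * a1) + a1 * (a1 * a2)))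
       * (?B$1$1 * ?B$2$2 * ?B$3$3)"
  note P = diagonal_trace_identities(1)[OF detA x uv uv', folded e_def]
    and Q = diagonal_trace_identities(2)[OF detA x uv uv', folded e_def]
  have t5: "tr_word [X1, X2, X1', X2'] (A, B) = e + (a1 * (a3 * a1) + a2 * (a1 * a2) + a3 * (a2 * a3)) * u
     + (a2 * (a2 * a3) + a3 * (a3 * a1) + a1 * (a1 * a2)) * v"
    unfolding e_def C u_def v_def using detA by (simp add: expand C) algebra
  have t5': "tr_word [X2, X1, X2', X1'] (A, B) = e + (a2 * (a2 * a3) + a3 * (a3 * a1) + a1 * (a1 * a2)) * u
     + (a1 * (a3 * a1) + a2 * (a1 * a2) + a3 * (a2 * a3)) * v"
    unfolding e_def C u_def v_def using detA by (simp add: expand C) algebra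
  show "at_traces P_poly (A, B) = tr_word [X1, X2, X1', X2'] (A, B) + tr_word [X2, X1, X2', X1'] (A, B)"
    unfolding at_traces_insertion t5 t5' by (rule P)
  show "at_traces Q_poly (A, B) = tr_word [X1, X2, X1', X2'] (A, B) * tr_word [X2, X1, X2', X1'] (A, B)"
    unfolding at_traces_insertion t5 t5' by (rule Q)
qed

lemma at_traces_hom:
  "at_traces (p + q) = at_traces p + at_traces q" "at_traces (p - q) = at_traces p - at_traces q"
  "at_traces (p * q) = at_traces p * at_traces q" "at_traces (- p) = - at_traces p"
  "at_traces (var g) = t_gen g" "at_traces (Poly_Mapping.single 0 c) = (\<lambda>\<rho>. c)"
  "at_traces 0 = 0" "at_traces 1 = 1"
  by (auto simp: at_traces_insertion fun_eq_iff)

lemma at_traces_double: "at_traces (2 * p) = at_traces p + at_traces p"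
  by (simp only: mult_2 at_traces_hom)

lemma at_traces_in_coordinate_ring [simp, intro]: "at_traces p \<in> coordinate_ring"
  by (induction p rule: poly9_induct)
    (simp_all only: at_traces_hom t_gen_def coordinate_ring_closed tr_word_in_coordinate_ring)

lemma coordinate_ring_regular: "f \<in> coordinate_ring \<Longrightarrow> f \<in> regular_functions"
  by (simp add: coordinate_ring_def)

lemma coordinate_ring_conj:
  "f \<in> coordinate_ring \<Longrightarrow> f (C * A * inverse C, C * B * inverse C) = f (A, B)"
  by (simp add: coordinate_ring_def)

text \<open>
  A pair of matrices at which neither the discriminant of the first matrix nor the difference of the
  two commutator traces vanishes, so that both functions may be cancelled.
\<close>

definition diag_witness :: sl3 where
  "diag_witness = Abs_sl3 (\<chi> i j. if i = j then (if i = 1 then 2 else if i = 2 then 1/2 else 1) else 0)"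
definition cyclic_witness :: sl3 where
  "cyclic_witness = Abs_sl3 (\<chi> i j. if (i, j) \<in> {(1, 2), (2, 3), (3, 1)} then 1 else 0)"

lemma Rep_witnesses:
  "Rep_sl3 diag_witness = (\<chi> i j. if i = j then (if i = 1 then 2 else if i = 2 then 1/2 else 1) else 0)"
  "Rep_sl3 cyclic_witness = (\<chi> i j. if (i, j) \<in> {(1, 2), (2, 3), (3, 1)} then 1 else 0)"
  unfolding diag_witness_def cyclic_witness_def by (simp_all add: Abs_sl3_inverse det_3)

lemma char_disc_witness: "char_disc diag_witness \<noteq> 0"
  unfolding char_disc_def tr_inverse_eq unfolding tr_eq
  by (simp add: Rep_witnesses power2_eq_square power3_eq_cube)

lemma commutator_witness:
  "tr_word [X1, X2, X1', X2'] (diag_witness, cyclic_witness)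
    \<noteq> tr_word [X2, X1, X2', X1'] (diag_witness, cyclic_witness)"
  by (simp add: tr_word_def tr_eq times_sl3.rep_eq matrix_matrix_mult_def sum_3 Rep_inverse adjugate3_def vector_3
    Rep_witnesses)

abbreviation t5_inv :: "rep \<Rightarrow> complex" where "t5_inv \<equiv> tr_word [X2, X1, X2', X1']"

text \<open>
  Matrices with non-zero discriminant can be diagonalised, and the discriminant may be cancelled.
\<close>

lemma eq_if_eq_on_diagonal:
  assumes f: "f \<in> coordinate_ring" and g: "g \<in> coordinate_ring"
    and diag: "\<And>A B. (\<And>i j. i \<noteq> j \<Longrightarrow> Rep_sl3 A $ i $ j = 0) \<Longrightarrow> f (A, B) = g (A, B)"
  shows "f = g"
proof -
  let ?h = "\<lambda>\<rho>. char_disc (fst \<rho>)"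
  have "?h = at_traces (t1^2 * t1'^2 - 4 * t1^3 - 4 * t1'^3 + 18 * t1 * t1' - 27)"
    by (auto simp: fun_eq_iff at_traces_insertion char_disc_def t_gen_def tr_word_def)
  then have h: "?h \<in> regular_functions"
    using coordinate_ring_regular[OF at_traces_in_coordinate_ring] by metis
  have "((f - g) * ?h) (A, B) = 0" for A B
  proof (cases "char_disc A = 0")
    case False
    then obtain C where "\<And>i j. i \<noteq> j \<Longrightarrow> Rep_sl3 (C * A * inverse C) $ i $ j = 0"
      using diagonalisable_if_char_disc_nonzero by metis
    then have "f (A, B) = g (A, B)"
      using diag[of "C * A * inverse C" "C * B * inverse C"]
      by (simp add: coordinate_ring_conj[OF f] coordinate_ring_conj[OF g])
    then show ?thesis by simp
  qed simp
  then have "(f - g) * ?h = 0" by (auto simp: fun_eq_iff)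
  then have "f - g = 0"
    using regular_zero_divisor[OF regular_diff[OF f[THEN coordinate_ring_regular]
        g[THEN coordinate_ring_regular]] h, where \<sigma> = "(diag_witness, cyclic_witness)"]
      char_disc_witness by simp
  then show ?thesis by simp
qed

lemma commutator_trace_sum: "at_traces P_poly = t_gen T5 + t5_inv"
  and commutator_trace_product: "at_traces Q_poly = t_gen T5 * t5_inv"
proof -
  show "at_traces P_poly = t_gen T5 + t5_inv"
    by (rule eq_if_eq_on_diagonal)
      (simp_all add: coordinate_ring_closed t_gen_def trace_identities_diagonal(1))
  show "at_traces Q_poly = t_gen T5 * t5_inv"
    by (rule eq_if_eq_on_diagonal)
      (simp_all add: coordinate_ring_closed t_gen_def trace_identities_diagonal(2))
qed

section \<open>Biderivations and the bracket of the generators\<close>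

definition commutator_relation :: poly9 where
  "commutator_relation = t5^2 - t5 * P_poly + Q_poly"

lemma at_traces_commutator_relation: "at_traces commutator_relation = 0"
  by (simp add: commutator_relation_def at_traces_hom power2_eq_square commutator_trace_sum
      commutator_trace_product algebra_simps)

lemma pdiff_commutator_relation:
  "pdiff T5 commutator_relation = 2 * t5 - P_poly"
  "g \<noteq> T5 \<Longrightarrow> pdiff g commutator_relation = pdiff g (Q_poly - t5 * P_poly)"
  by (simp_all add: commutator_relation_def pdiff_T5_P pdiff_T5_Q)

text \<open>
  By the relation, \<open>2 t\<^bsub>(5)\<^esub> - P = t\<^bsub>(5)\<^esub> - t\<^bsub>(-5)\<^esub>\<close>, which does not vanish identically.
\<close>

lemma cancel_two_t5_minus_P:
  assumes f: "f \<in> coordinate_ring" and g: "g \<in> coordinate_ring"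
    and eq: "at_traces (2 * t5 - P_poly) * f = at_traces (2 * t5 - P_poly) * g"
  shows "f = g"
proof -
  have "f - g \<in> regular_functions"
    using f g by (intro regular_diff coordinate_ring_regular)
  moreover have "at_traces (2 * t5 - P_poly) \<in> regular_functions"
    by (intro coordinate_ring_regular at_traces_in_coordinate_ring)
  moreover have "(f - g) * at_traces (2 * t5 - P_poly) = 0"
    using eq by (simp add: right_diff_distrib mult.commute[of "f - g"])
  moreover have "at_traces (2 * t5 - P_poly) = t_gen T5 - t5_inv"
    by (simp add: at_traces_hom(2,5) at_traces_double commutator_trace_sum)
  then have "at_traces (2 * t5 - P_poly) (diag_witness, cyclic_witness) \<noteq> 0"
    using commutator_witness by (simp add: t_gen_def)
  ultimately have "f - g = 0" by (rule regular_zero_divisor)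
  then show ?thesis by simp
qed

text \<open>
  A derivation over \<open>\<complex>\<close> from the coordinate ring to functions: linearity is encoded as additivity
  together with vanishing on constants.
\<close>

definition ring_derivation :: "((rep \<Rightarrow> complex) \<Rightarrow> rep \<Rightarrow> complex) \<Rightarrow> bool" where
  "ring_derivation D \<longleftrightarrow> (\<forall>c. D (\<lambda>\<rho>. c) = 0) \<and> (\<forall>f\<in>coordinate_ring. \<forall>g\<in>coordinate_ring.
     D (f + g) = D f + D g \<and> D (f * g) = f * D g + g * D f)"

text \<open>
  Both sides are derivations in \<open>F\<close> and agree on the variables.
\<close>

lemma chain_rule:
  assumes "ring_derivation D"
  shows "D (at_traces F) = (\<Sum>g\<in>UNIV. at_traces (pdiff g F) * D (t_gen g))"
proof (induction F rule: poly9_induct)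
  case (const c)
  then show ?case using assms by (simp add: at_traces_hom ring_derivation_def)
next
  case (var g)
  have "at_traces (pdiff h (var g)) * D (t_gen h) = (if h = g then D (t_gen h) else 0)" for h
    by (simp add: at_traces_hom)
  then show ?case by (simp add: at_traces_hom)
next
  case (add p q)
  have "D (at_traces (p + q)) = D (at_traces p) + D (at_traces q)"
    using assms by (simp only: at_traces_hom ring_derivation_def at_traces_in_coordinate_ring)
  then show ?case
    unfolding add by (simp only: pdiff_add at_traces_hom sum.distrib distrib_right)
next
  case (mult p q)
  have "D (at_traces (p * q)) = at_traces p * D (at_traces q) + at_traces q * D (at_traces p)"
    using assms by (simp only: at_traces_hom ring_derivation_def at_traces_in_coordinate_ring)
  then show ?case
    unfolding mult
    by (simp only: pdiff_mult at_traces_hom sum.distrib sum_distrib_left distrib_left distrib_right mult_ac add_ac)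
qed

lemma poisson_bracket_derivation:
  assumes B: "poisson_bracket s B" and h: "h \<in> coordinate_ring"
  shows "ring_derivation (\<lambda>f. B f h)" "ring_derivation (B h)"
proof -
  have one: "1 \<in> coordinate_ring" using coordinate_ring_closed(1)[of 1] by (simp add: one_fun_def)
  have leibniz: "B (f * g) h = f * B g h + g * B f h" if "f \<in> coordinate_ring" "g \<in> coordinate_ring" for f g
    using B h that unfolding poisson_bracket_def by blast
  have antisym: "B f h = - B h f" "B h f = - B f h" if "f \<in> coordinate_ring" for f
    using B h that unfolding poisson_bracket_def by blast+
  have bilinear: "B (f + g) h = B f h + B g h" "B ((\<lambda>_. c) * f) h = (\<lambda>_. c) * B f h"
    if "f \<in> coordinate_ring" "g \<in> coordinate_ring" for f g c
    using B h that unfolding poisson_bracket_def bilinear_on_coordinate_ring_def by blast+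
  have "B 1 h = 0" using leibniz[OF one one] by simp
  then have const: "B (\<lambda>_. c) h = 0" for c
    using bilinear(2)[OF one one, of c] by simp
  show "ring_derivation (\<lambda>f. B f h)"
    unfolding ring_derivation_def using const leibniz bilinear by blast
  then show "ring_derivation (B h)"
    unfolding ring_derivation_def using antisym(2) coordinate_ring_closed by (simp add: algebra_simps)
qed

text \<open>
  The coefficients of a bi-vector field enter the bracket only after antisymmetrisation.
\<close>

lemma has_bivectorI:
  assumes B: "poisson_bracket s B" and W: "\<And>u v. B (t_gen u) (t_gen v) = W u v - W v u"
  shows "has_bivector B W"
  unfolding has_bivector_def
proof (intro allI)
  fix F G
  let ?F = "\<lambda>u. at_traces (pdiff u F)" and ?G = "\<lambda>v. at_traces (pdiff v G)"
  have t: "t_gen u \<in> coordinate_ring" for u by (simp add: t_gen_def)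
  have "B (at_traces F) (at_traces G) = (\<Sum>u\<in>UNIV. ?F u * B (t_gen u) (at_traces G))"
    by (rule chain_rule[OF poisson_bracket_derivation(1)[OF B]]) simp
  also have "\<dots> = (\<Sum>u\<in>UNIV. ?F u * (\<Sum>v\<in>UNIV. ?G v * B (t_gen u) (t_gen v)))"
    by (intro sum.cong refl arg_cong2[where f = times] chain_rule[OF poisson_bracket_derivation(2)[OF B t]])
  also have "\<dots> = (\<Sum>u\<in>UNIV. \<Sum>v\<in>UNIV. W u v * (?F u * ?G v)) - (\<Sum>u\<in>UNIV. \<Sum>v\<in>UNIV. W v u * (?F u * ?G v))"
    by (simp add: W sum_distrib_left algebra_simps flip: sum_subtractf)
  also have "(\<Sum>u\<in>UNIV. \<Sum>v\<in>UNIV. W v u * (?F u * ?G v)) = (\<Sum>u\<in>UNIV. \<Sum>v\<in>UNIV. W u v * (?F v * ?G u))"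
    by (rule sum.swap)
  also have "(\<Sum>u\<in>UNIV. \<Sum>v\<in>UNIV. W u v * (?F u * ?G v)) - \<dots>
      = (\<Sum>u\<in>UNIV. \<Sum>v\<in>UNIV. W u v * at_traces (pdiff u F * pdiff v G - pdiff v F * pdiff u G))"
    by (simp add: at_traces_hom algebra_simps flip: sum_subtractf)
  finally show "B (at_traces F) (at_traces G)
      = (\<Sum>u\<in>UNIV. \<Sum>v\<in>UNIV. W u v * at_traces (pdiff u F * pdiff v G - pdiff v F * pdiff u G))" .
qed

text \<open>
  The signs at the two intersections are opposite, so the terms \<open>1/3 tr \<alpha> tr \<beta>\<close> cancel, and what remains
  is the difference of the traces of the inverse commutator and of the commutator.
\<close>

lemma bracket_T4_T4':
  assumes "standard_orientation s" "goldman_formula s B"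
  shows "B (t_gen T4) (t_gen T4') = at_traces (P_poly - 2 * t5)"
proof -
  obtain \<alpha> \<beta> p q where ab: "generic_position \<alpha> \<beta>" "represents [X1, X2'] \<alpha>" "represents [X2, X1'] \<beta>"
    and pq: "p \<noteq> q" "intersections \<alpha> \<beta> = {p, q}"
      "represents [X2', X1, X2, X1'] (loop_at \<alpha> p +++ loop_at \<beta> p)"
      "represents [X1, X2', X1', X2] (loop_at \<alpha> q +++ loop_at \<beta> q)"
      "intersection_number s p \<alpha> \<beta> = -1" "intersection_number s q \<alpha> \<beta> = 1"
    using assms(1) unfolding standard_orientation_def by blast
  define w where "w z = (if z = p then [X2', X1, X2, X1'] else [X1, X2', X1', X2])" for z
  have "\<forall>z\<in>intersections \<alpha> \<beta>. represents (w z) (loop_at \<alpha> z +++ loop_at \<beta> z)"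
    using pq by (simp add: w_def)
  then have "B (tr_word [X1, X2']) (tr_word [X2, X1']) = (\<lambda>\<rho>. \<Sum>z\<in>intersections \<alpha> \<beta>.
      of_real (intersection_number s z \<alpha> \<beta>) *
        (tr_word (w z) \<rho> - 1/3 * tr_word [X1, X2'] \<rho> * tr_word [X2, X1'] \<rho>))"
    using ab assms(2) unfolding goldman_formula_def by blast
  also have "\<dots> = tr_word [X1, X2', X1', X2] - tr_word [X2', X1, X2, X1']"
    using pq by (auto simp: w_def fun_eq_iff)
  also have "tr_word [X1, X2', X1', X2] = t5_inv"
  proof
    fix \<rho>
    show "tr_word [X1, X2', X1', X2] \<rho> = t5_inv \<rho>"
      using tr_commute[of "eval_word \<rho> [X1, X2', X1']" "eval_word \<rho> [X2]"]
      by (simp add: tr_word_def mult.assoc)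
  qed
  also have "tr_word [X2', X1, X2, X1'] = t_gen T5"
  proof
    fix \<rho>
    show "tr_word [X2', X1, X2, X1'] \<rho> = t_gen T5 \<rho>"
      using tr_commute[of "eval_word \<rho> [X2']" "eval_word \<rho> [X1, X2, X1']"]
      by (simp add: tr_word_def t_gen_def mult.assoc)
  qed
  also have "tr_word [X2, X1'] = t_gen T4'"
  proof
    fix \<rho>
    show "tr_word [X2, X1'] \<rho> = t_gen T4' \<rho>"
      using tr_commute[of "eval_word \<rho> [X2]" "eval_word \<rho> [X1']"] by (simp add: tr_word_def t_gen_def)
  qed
  finally show ?thesis
    by (simp add: t_gen_def[of T4] at_traces_hom(2,5) at_traces_double commutator_trace_sum fun_diff_def)
qed

lemma act_inv_aut_at_traces: "act inv_aut (at_traces p) = (\<lambda>\<rho>. insertion ((\<lambda>g. t_gen g \<rho>) \<circ> inv_gen) p)"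
proof
  fix \<rho>
  have "t_gen g (eval_word \<rho> (fst inv_aut), eval_word \<rho> (snd inv_aut)) = t_gen (inv_gen g) \<rho>" for g
    using fun_cong[OF act_inv_aut_t_gen[of g], of \<rho>] by (simp add: act_def)
  then show "act inv_aut (at_traces p) \<rho> = insertion ((\<lambda>g. t_gen g \<rho>) \<circ> inv_gen) p"
    by (simp add: act_def at_traces_insertion comp_def)
qed

lemma act_inv_aut_pdiff:
  "act inv_aut (at_traces (pdiff T4' (Q_poly - t5 * P_poly)))
    = at_traces (pdiff T4 (Q_poly - t5 * P_poly))"
  unfolding act_inv_aut_at_traces insertion_inv_gen_pdiff at_traces_insertion ..

theorem corollary26:
  fixes s :: real
    and B :: "(rep \<Rightarrow> complex) \<Rightarrow> (rep \<Rightarrow> complex) \<Rightarrow> (rep \<Rightarrow> complex)"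
  assumes "standard_orientation s"
    and "poisson_bracket s B"
  shows "B (t_gen T4') (t_gen T5) = - act inv_aut (B (t_gen T4) (t_gen T5)) \<and>
    (let D = wedge (at_traces (pdiff T4' (Q_poly - t5 * P_poly))) T4 T5
     in has_bivector B (wedge (at_traces (P_poly - 2 * t5)) T4 T4' + (D - inv_bivector D)))"
proof -
  let ?R = "Q_poly - t5 * P_poly"
  have goldman: "goldman_formula s B" using assms(2) by (simp add: poisson_bracket_def)
  have t: "t_gen u \<in> coordinate_ring" for u by (simp add: t_gen_def)
  have antisym: "B (t_gen u) (t_gen v) = - B (t_gen v) (t_gen u)" for u v
    using assms(2) t unfolding poisson_bracket_def by blast
  have self: "B (t_gen u) (t_gen u) = 0" for u
    using antisym[of u u] by (auto simp: fun_eq_iff)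
  have closed: "B (t_gen u) (t_gen v) \<in> coordinate_ring" for u v
    using assms(2) t unfolding poisson_bracket_def by blast
  \<comment> \<open>The derivation \<open>{u, _}\<close> applied to \<open>t\<^bsub>(5)\<^esub>\<^sup>2 - t\<^bsub>(5)\<^esub> P + Q = 0\<close>.\<close>
  have relation: "(\<Sum>g\<in>UNIV. at_traces (pdiff g commutator_relation) * B (t_gen u) (t_gen g)) = 0" for u
  proof -
    have deriv: "ring_derivation (B (t_gen u))" by (rule poisson_bracket_derivation[OF assms(2) t])
    then have "B (t_gen u) 0 = 0" unfolding ring_derivation_def zero_fun_def by blast
    then show ?thesis
      using chain_rule[OF deriv, of commutator_relation] by (simp add: at_traces_commutator_relation)
  qed
  \<comment> \<open>For a boundary curve only the term of \<open>t\<^bsub>(5)\<^esub>\<close> is left in the relation.\<close>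
  have peripheral: "B (t_gen u) (t_gen v) = 0" if "u \<in> peripheral" for u v
  proof -
    have not_T5: "B (t_gen u) (t_gen g) = 0" if "g \<noteq> T5" for g
      using goldman_peripheral[OF goldman \<open>u \<in> peripheral\<close> that] .
    then have "at_traces (2 * t5 - P_poly) * B (t_gen u) (t_gen T5)
        = at_traces (2 * t5 - P_poly) * at_traces 0"
      using relation[of u]
      by (simp add: UNIV_gen pdiff_commutator_relation at_traces_hom(7) del: pdiff_diff pdiff_mult)
    then have "B (t_gen u) (t_gen T5) = at_traces 0"
      by (rule cancel_two_t5_minus_P[OF closed at_traces_in_coordinate_ring])
    then have "B (t_gen u) (t_gen T5) = 0" by (simp add: at_traces_hom(7))
    then show ?thesis using not_T5 by (cases "v = T5") auto
  qed
  then have peripheral': "B (t_gen v) (t_gen u) = 0" if "u \<in> peripheral" for u v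
    using antisym[of v u] that by simp
  have T4_T4': "B (t_gen T4) (t_gen T4') = at_traces (P_poly - 2 * t5)"
    by (rule bracket_T4_T4'[OF assms(1) goldman])
  have P2: "at_traces (P_poly - 2 * t5) = - at_traces (2 * t5 - P_poly)" by (simp flip: at_traces_hom)
  have reduced: "at_traces (pdiff T4 ?R) * B (t_gen u) (t_gen T4)
      + at_traces (pdiff T4' ?R) * B (t_gen u) (t_gen T4')
      + at_traces (2 * t5 - P_poly) * B (t_gen u) (t_gen T5) = 0" for u
    using relation[of u]
    by (simp add: UNIV_gen pdiff_commutator_relation peripheral' peripheral_def add_ac del: pdiff_diff pdiff_mult)
  have rearrange: "p * x = p * r" if "r * (- p) + p * x = 0" for p x r :: "rep \<Rightarrow> complex"
    using that by (simp add: mult.commute)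
  have "at_traces (2 * t5 - P_poly) * B (t_gen T4) (t_gen T5)
      = at_traces (2 * t5 - P_poly) * at_traces (pdiff T4' ?R)"
    using reduced[of T4] by (intro rearrange) (simp only: self T4_T4' P2 mult_zero_right add_0_left)
  then have T4_T5: "B (t_gen T4) (t_gen T5) = at_traces (pdiff T4' ?R)"
    by (rule cancel_two_t5_minus_P[OF closed at_traces_in_coordinate_ring])
  have "at_traces (2 * t5 - P_poly) * B (t_gen T4') (t_gen T5)
      = at_traces (2 * t5 - P_poly) * at_traces (- pdiff T4 ?R)"
    using reduced[of T4'] unfolding at_traces_hom(4)
    by (intro rearrange)
      (simp only: self antisym[of T4' T4] T4_T4' P2 mult_zero_right add_0_right minus_mult_minus minus_minus)
  then have "B (t_gen T4') (t_gen T5) = at_traces (- pdiff T4 ?R)"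
    by (rule cancel_two_t5_minus_P[OF closed at_traces_in_coordinate_ring])
  then have T4'_T5: "B (t_gen T4') (t_gen T5) = - at_traces (pdiff T4 ?R)"
    by (simp only: at_traces_hom(4))
  define D where "D = wedge (at_traces (pdiff T4' ?R)) T4 T5"
  have invD: "inv_bivector D = wedge (at_traces (pdiff T4 ?R)) T4' T5"
    by (simp only: D_def inv_bivector_wedge act_inv_aut_pdiff inv_gen.simps)
  let ?W = "wedge (at_traces (P_poly - 2 * t5)) T4 T4' + (D - inv_bivector D)"
  have "B (t_gen u) (t_gen v) = ?W u v - ?W v u" for u v
  proof (cases "u \<in> peripheral \<or> v \<in> peripheral")
    case True
    moreover have "?W u v = 0" "?W v u = 0"
      using True unfolding invD by (auto simp: D_def wedge_def peripheral_def)
    ultimately show ?thesis using peripheral[of u v] peripheral'[of v u] by auto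
  next
    case False
    moreover have "x \<in> {T4, T4', T5}" if "x \<notin> peripheral" for x
      using that by (cases x) (simp_all add: peripheral_def)
    ultimately have "u \<in> {T4, T4', T5}" "v \<in> {T4, T4', T5}" by simp_all
    then show ?thesis
      unfolding invD using antisym[of T4' T4] antisym[of T5 T4] antisym[of T5 T4']
      by (auto simp: D_def wedge_def self T4_T4' T4_T5 T4'_T5 simp del: pdiff_diff pdiff_mult)
  qed
  then have "has_bivector B ?W" by (rule has_bivectorI[OF assms(2)])
  moreover have "B (t_gen T4') (t_gen T5) = - act inv_aut (B (t_gen T4) (t_gen T5))"
    unfolding T4'_T5 T4_T5 act_inv_aut_pdiff ..
  ultimately show ?thesis by (simp only: Let_def D_def)
qed

end
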